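(* Let $V\in\mathcal K_{loc}$ and let $f\ge0$, $f\in(\Delta^{-1}\mathcal K_0)_{loc}$, be a solution on $\mathbb R^3$ of the boundary-value problem $$-\Delta f+Vf=g\ge0,\qquad\liminf_{x\to\infty}f(x)\ge0.$$ If $f\not\equiv0$, then $f>0$ (everywhere on $\mathbb R^3$).
   Context: $V\in\mathcal K_{loc}$ ($V$ real-valued) means that for any $y\in\mathbb R^3$ there exists $R>0$ such that $\int_{B(y,R)}\frac{|V(x)|\,dx}{|x-y|}<\infty$. $\mathcal K_0$ is the closure of $C_c^\infty(\mathbb R^3)$ in the global Kato norm $\|V\|_{\mathcal K}=\sup_{y\in\mathbb R^3}\int_{\mathbb R^3}\frac{|V(x)|\,dx}{|x-y|}$. $\Delta^{-1}\mathcal K_0$ is the space of functions $\Delta^{-1}h$, $h\in\mathcal K_0$, where $\Delta^{-1}$ is convolution with $-\frac1{4\pi|x|}$, and $(\Delta^{-1}\mathcal K_0)_{loc}$ is the space of functions that locally coincide with elements of $\Delta^{-1}\mathcal K_0$; such functions are continuous. *)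

theory Defs
  imports "HOL-Analysis.Analysis"
begin

definition partial_deriv :: "real^3 \<Rightarrow> (real^3 \<Rightarrow> real) \<Rightarrow> real^3 \<Rightarrow> real" where
  "partial_deriv i u x = frechet_derivative u (at x) i"

definition laplacian :: "(real^3 \<Rightarrow> real) \<Rightarrow> real^3 \<Rightarrow> real" where
  "laplacian u x = (\<Sum>i\<in>Basis. partial_deriv i (partial_deriv i u) x)"

fun C_k :: "nat \<Rightarrow> (real^3 \<Rightarrow> real) \<Rightarrow> bool" where
  "C_k 0 u \<longleftrightarrow> continuous_on UNIV u"
| "C_k (Suc k) u \<longleftrightarrow> (\<forall>x. u differentiable (at x)) \<and> (\<forall>i\<in>Basis. C_k k (partial_deriv i u))"

definition Cc_infinity :: "(real^3 \<Rightarrow> real) set" where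
  "Cc_infinity = {\<phi>. (\<forall>k. C_k k \<phi>) \<and> compact (closure {x. \<phi> x \<noteq> 0})}"

text \<open>In the Kato integrals the singular point \<open>x = y\<close> contributes \<open>_ / 0 = 0\<close>, which is harmless
  since a single point is Lebesgue-null.\<close>

definition K_loc :: "(real^3 \<Rightarrow> real) set" where
  "K_loc = {V \<in> borel_measurable lebesgue.
     \<forall>y. \<exists>R>0. (\<integral>\<^sup>+x\<in>ball y R. ennreal (\<bar>V x\<bar> / norm (x - y)) \<partial>lebesgue) < \<infinity>}"

definition kato_norm :: "(real^3 \<Rightarrow> real) \<Rightarrow> ennreal" where
  "kato_norm V = (SUP y. \<integral>\<^sup>+x. ennreal (\<bar>V x\<bar> / norm (x - y)) \<partial>lebesgue)"

text \<open>Finiteness of the Kato norm on \<open>K_0\<close> is automatic, as it is finite on \<open>Cc_infinity\<close>.\<close>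

definition K_0 :: "(real^3 \<Rightarrow> real) set" where
  "K_0 = {h \<in> borel_measurable lebesgue.
     \<forall>\<epsilon>>0. \<exists>\<phi>\<in>Cc_infinity. kato_norm (\<lambda>x. h x - \<phi> x) < ennreal \<epsilon>}"

definition inv_laplacian :: "(real^3 \<Rightarrow> real) \<Rightarrow> real^3 \<Rightarrow> real" where
  "inv_laplacian h x = (LINT y|lebesgue. - 1 / (4 * pi * norm (x - y)) * h y)"

text \<open>Functions that locally coincide with elements of a space \<open>X\<close>. The coincidence is pointwise, not
  merely almost everywhere: for \<open>X = inv_laplacian ` K_0\<close> this selects the continuous
  representative.\<close>

definition locally_in :: "(real^3 \<Rightarrow> real) set \<Rightarrow> (real^3 \<Rightarrow> real) set" where
  "locally_in X = {f. \<forall>y. \<exists>r>0. \<exists>u\<in>X. \<forall>x\<in>ball y r. f x = u x}"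

definition L1_loc :: "(real^3 \<Rightarrow> real) set" where
  "L1_loc = {g. \<forall>K. compact K \<longrightarrow> set_integrable lebesgue K g}"

text \<open>The equation \<open>- \<Delta> f + V f = g\<close> in the sense of distributions. For \<open>V \<in> K_loc\<close>, \<open>f\<close>
  continuous and \<open>g \<in> L1_loc\<close>, the functions \<open>f\<close>, \<open>V f\<close> and \<open>g\<close> are all locally integrable, so the
  integrals below are genuine.\<close>

definition schroedinger_solution ::
  "(real^3 \<Rightarrow> real) \<Rightarrow> (real^3 \<Rightarrow> real) \<Rightarrow> (real^3 \<Rightarrow> real) \<Rightarrow> bool" where
  "schroedinger_solution V f g \<longleftrightarrow>
     (\<forall>\<phi>\<in>Cc_infinity.
        (LINT x|lebesgue. - f x * laplacian \<phi> x + V x * f x * \<phi> x) =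
        (LINT x|lebesgue. g x * \<phi> x))"

end

theory Submission
  imports Defs
begin

text \<open>
  The zero set of the continuous function \<open>f\<close> is closed; the point is that it is open. Since
  \<open>f \<ge> 0\<close>, the equation gives \<open>\<Delta>f \<le> V\<^sub>+ f\<close>, and by concavity of the logarithm
  \<open>\<Delta> ln (f + \<epsilon>) \<le> V\<^sub>+ f / (f + \<epsilon>) \<le> V\<^sub>+\<close> in the sense of distributions. If \<open>f y = 0\<close>, testing
  \<open>ln ((f + \<epsilon>) / \<epsilon>) \<ge> 0\<close> with a function that behaves like \<open>1 / |x - y|\<close> near \<open>y\<close>, is supported in the
  ball where the Kato integral converges and is strictly subharmonic there away from \<open>y\<close>, bounds weighted
  integrals of \<open>ln ((f + \<epsilon>) / \<epsilon>)\<close> by the Kato integral at \<open>y\<close>, uniformly in \<open>\<epsilon>\<close>. Letting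
  \<open>\<epsilon> \<rightarrow> 0\<close> forces \<open>f = 0\<close> on that ball.

  The chain rule for \<open>ln\<close> is avoided: for a mollification of \<open>f\<close> the inequality
  \<open>ln a - ln b \<le> (a - b) / b\<close> is applied to second difference quotients, which can be moved onto the test
  function by translation invariance.
\<close>

section \<open>Calculus of the classes C^k\<close>

text \<open>The Kato integral of \<open>V\<close> is finite at each single point, with no uniform
  smallness over nearby centres, so the estimate has to live at the one centre \<open>y\<close>. Two
  facts make this possible. The function \<open>ln ((f + \<epsilon>) / \<epsilon>)\<close> vanishes
  at \<open>y\<close>, which disarms the point mass that the Laplacian of \<open>1 / |x - y|\<close>
  carries there; and where \<open>f > 0\<close> it grows without bound as \<epsilon> tends to 0.

  The other obstacle is regularity: \<open>f\<close> is only continuous, and the equation admits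
  only smooth test functions. It is tested with translates of a mollifier alone; the rest is
  integration of the resulting pointwise inequality, so the functions used against the logarithm may
  be merely C^2. Once the mollification radius is so small that \<open>f\<close> oscillates by at
  most \<open>\<epsilon> / 2\<close>, nearby values of \<open>f\<close> are bounded by the
  denominator of the logarithmic derivative and cancel against it. The singular
  \<open>1 / |x - y|\<close> becomes a function of \<open>sqrt (|x - y|^2 + s^2)\<close>. The step
  \<open>h\<close> and the radius \<tau> go to 0 with \<epsilon> fixed, \<open>s\<close> is then
  chosen depending on \<epsilon>, and \<epsilon> comes last.\<close>

lemma partial_deriv_eq:
  assumes "(u has_derivative u') (at x)"
  shows "partial_deriv i u x = u' i"
  unfolding partial_deriv_def using frechet_derivative_at[OF assms] by simp

lemma C_k_SucI:
  assumes "\<And>x. (u has_derivative u' x) (at x)" and "\<And>i. i \<in> Basis \<Longrightarrow> C_k k (\<lambda>x. u' x i)"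
  shows "C_k (Suc k) u"
proof -
  have "partial_deriv i u = (\<lambda>x. u' x i)" for i
    using partial_deriv_eq[OF assms(1)] by auto
  then show ?thesis
    using assms by (auto simp: differentiable_def)
qed

lemma C_k_imp_continuous: "C_k k u \<Longrightarrow> continuous_on UNIV u"
  by (cases k) (auto intro!: continuous_at_imp_continuous_on differentiable_imp_continuous_within)

lemma C_k_SucD: "C_k (Suc k) u \<Longrightarrow> C_k k u"
proof (induction k arbitrary: u)
  case 0
  then show ?case using C_k_imp_continuous[OF 0] by simp
next
  case (Suc k)
  from Suc.prems have "\<forall>x. u differentiable (at x)" "\<forall>i\<in>Basis. C_k (Suc k) (partial_deriv i u)"
    using C_k.simps(2)[of "Suc k" u] by blast+
  then show ?case using Suc.IH by (simp only: C_k.simps(2)[of k]) blast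
qed

lemma C_k_const [simp]: "C_k k (\<lambda>x. c)"
proof (induction k arbitrary: c)
  case (Suc k)
  show ?case by (rule C_k_SucI[where u' = "\<lambda>x v. 0"]) (use Suc in auto)
qed simp

lemma C_k_Suc_has_derivative:
  assumes "C_k (Suc k) u"
  shows "(u has_derivative (\<lambda>v. frechet_derivative u (at x) v)) (at x)"
  using assms by (simp add: frechet_derivative_works[symmetric])

lemma C_k_add: "C_k k u \<Longrightarrow> C_k k v \<Longrightarrow> C_k k (\<lambda>x. u x + v x)"
proof (induction k arbitrary: u v)
  case (Suc k)
  show ?case
  proof (rule C_k_SucI)
    show "((\<lambda>x. u x + v x) has_derivative
        (\<lambda>w. frechet_derivative u (at x) w + frechet_derivative v (at x) w)) (at x)" for x
      by (intro has_derivative_add C_k_Suc_has_derivative[OF Suc.prems(1)]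
          C_k_Suc_has_derivative[OF Suc.prems(2)])
    show "C_k k (\<lambda>x. frechet_derivative u (at x) i + frechet_derivative v (at x) i)"
      if "i \<in> Basis" for i
      using Suc.IH[of "partial_deriv i u" "partial_deriv i v"] Suc.prems that
      by (simp add: partial_deriv_def[abs_def])
  qed
qed (auto intro: continuous_intros)

lemma C_k_mult: "C_k k u \<Longrightarrow> C_k k v \<Longrightarrow> C_k k (\<lambda>x. u x * v x)"
proof (induction k arbitrary: u v)
  case (Suc k)
  show ?case
  proof (rule C_k_SucI)
    show "((\<lambda>x. u x * v x) has_derivative
        (\<lambda>w. u x * frechet_derivative v (at x) w + frechet_derivative u (at x) w * v x)) (at x)" for x
      by (intro has_derivative_mult C_k_Suc_has_derivative[OF Suc.prems(1)]
          C_k_Suc_has_derivative[OF Suc.prems(2)])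
    show "C_k k (\<lambda>x. u x * frechet_derivative v (at x) i + frechet_derivative u (at x) i * v x)"
      if "i \<in> Basis" for i
      using Suc.IH[of u "partial_deriv i v"] Suc.IH[of "partial_deriv i u" v] Suc.prems that
        C_k_SucD[OF Suc.prems(1)] C_k_SucD[OF Suc.prems(2)]
      by (intro C_k_add) (simp_all add: partial_deriv_def[abs_def])
  qed
qed (auto intro: continuous_intros)

lemma C_k_compose:
  assumes "\<And>m x. m < k \<Longrightarrow> (G m has_real_derivative G (Suc m) (u x)) (at (u x))"
    and "continuous_on (range u) (G k)" and "C_k k u"
  shows "C_k k (\<lambda>x. G 0 (u x))"
  using assms
proof (induction k arbitrary: G)
  case 0
  then show ?case
    using continuous_on_compose2[of "range u" "G 0" UNIV u] by auto
next
  case (Suc k)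
  show ?case
  proof (rule C_k_SucI)
    show "((\<lambda>x. G 0 (u x)) has_derivative
        (\<lambda>w. G 1 (u x) * frechet_derivative u (at x) w)) (at x)" for x
      using has_derivative_compose[OF C_k_Suc_has_derivative[OF Suc.prems(3), of x],
          of "G 0" "\<lambda>t. G 1 (u x) * t"]
        Suc.prems(1)[of 0 x] by (simp add: has_field_derivative_def)
    show "C_k k (\<lambda>x. G 1 (u x) * frechet_derivative u (at x) i)" if "i \<in> Basis" for i
      using Suc.IH[of "\<lambda>m. G (Suc m)"] Suc.prems that C_k_SucD[OF Suc.prems(3)]
      by (intro C_k_mult) (simp_all add: partial_deriv_def[abs_def])
  qed
qed

lemma has_derivative_sq_dist:
  "((\<lambda>x::'a::real_inner. (x - y) \<bullet> (x - y)) has_derivative (\<lambda>v. 2 * ((x - y) \<bullet> v))) (at x)"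
  by (auto intro!: derivative_eq_intros simp: inner_commute)

lemma C_k_sq_dist: "C_k k (\<lambda>x. (x - y) \<bullet> (x - y))"
proof (cases k)
  case (Suc j)
  have "C_k j (\<lambda>x. 2 * ((x - y) \<bullet> i))" for i
  proof (cases j)
    case (Suc m)
    show ?thesis unfolding Suc
      by (rule C_k_SucI[where u' = "\<lambda>x v. 2 * (v \<bullet> i)"]) (auto intro!: derivative_eq_intros)
  qed (auto intro!: continuous_intros)
  then show ?thesis unfolding Suc by (intro C_k_SucI[OF has_derivative_sq_dist])
qed (auto intro!: continuous_intros)

lemma C_k_radial:
  assumes "\<And>m t. m < k \<Longrightarrow> 0 \<le> t \<Longrightarrow> (G m has_real_derivative G (Suc m) t) (at t)"
    and "continuous_on {0..} (G k)"
  shows "C_k k (\<lambda>x. G 0 ((x - y) \<bullet> (x - y)))"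
proof (rule C_k_compose[OF _ _ C_k_sq_dist])
  show "continuous_on (range (\<lambda>x. (x - y) \<bullet> (x - y))) (G k)"
    by (rule continuous_on_subset[OF assms(2)]) auto
qed (use assms(1) in auto)

text \<open>Profiles are functions of the squared distance, which is smooth at the centre too. The
  gradient of the squared distance has square \<open>4 * t\<close>, and its Laplacian is twice the
  dimension, hence the 6.\<close>

lemma laplacian_radial:
  assumes "\<And>t. 0 \<le> t \<Longrightarrow> (G0 has_real_derivative G1 t) (at t)"
    and "\<And>t. 0 \<le> t \<Longrightarrow> (G1 has_real_derivative G2 t) (at t)"
  shows "laplacian (\<lambda>x. G0 ((x - y) \<bullet> (x - y))) x
       = 4 * ((x - y) \<bullet> (x - y)) * G2 ((x - y) \<bullet> (x - y)) + 6 * G1 ((x - y) \<bullet> (x - y))"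
proof -
  let ?n = "\<lambda>x::real^3. (x - y) \<bullet> (x - y)"
  have G: "((\<lambda>x. G (?n x)) has_derivative (\<lambda>v. G' (?n x) * (2 * ((x - y) \<bullet> v)))) (at x)"
    if "\<And>t. 0 \<le> t \<Longrightarrow> (G has_real_derivative G' t) (at t)" for G G' x
    using has_derivative_compose[OF has_derivative_sq_dist[of y x], of G "\<lambda>t. G' (?n x) * t"]
      that[of "?n x"] by (simp add: has_field_derivative_def)
  have 1: "partial_deriv i (\<lambda>x. G0 (?n x)) = (\<lambda>x. G1 (?n x) * (2 * ((x - y) \<bullet> i)))" for i
    by (rule ext) (rule partial_deriv_eq[OF G[OF assms(1)]])
  have 2: "partial_deriv i (partial_deriv i (\<lambda>x. G0 (?n x))) x
      = 4 * G2 (?n x) * ((x - y) \<bullet> i)\<^sup>2 + 2 * G1 (?n x)" if "i \<in> Basis" for i x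
  proof -
    have "((\<lambda>x. G1 (?n x) * (2 * ((x - y) \<bullet> i))) has_derivative
        (\<lambda>v. G1 (?n x) * (2 * (v \<bullet> i)) + G2 (?n x) * (2 * ((x - y) \<bullet> v)) * (2 * ((x - y) \<bullet> i)))) (at x)"
      by (rule has_derivative_mult[OF G[OF assms(2)]]) (auto intro!: derivative_eq_intros)
    from partial_deriv_eq[OF this, of i] that show ?thesis unfolding 1
      by (simp add: power2_eq_square algebra_simps)
  qed
  have "laplacian (\<lambda>x. G0 (?n x)) x = (\<Sum>i\<in>Basis. 4 * G2 (?n x) * ((x - y) \<bullet> i)\<^sup>2 + 2 * G1 (?n x))"
    unfolding laplacian_def using 2 by simp
  also have "\<dots> = 4 * G2 (?n x) * (\<Sum>i\<in>Basis. ((x - y) \<bullet> i)\<^sup>2) + 6 * G1 (?n x)"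
    by (simp add: sum.distrib sum_distrib_left)
  also have "(\<Sum>i\<in>Basis. ((x - y) \<bullet> i)\<^sup>2) = ?n x"
    by (subst euclidean_inner) (simp add: power2_eq_square)
  finally show ?thesis by (simp add: algebra_simps)
qed

section \<open>Flat functions\<close>

text \<open>The polynomial is a parameter because the family is then closed under differentiation;
  \<open>flat 1\<close> is the usual \<open>exp (- 1 / t)\<close> continued by zero.\<close>

definition flat :: "real poly \<Rightarrow> real \<Rightarrow> real" where
  "flat p t = (if t > 0 then poly p (1 / t) * exp (- 1 / t) else 0)"

text \<open>Differentiating \<open>p(1/t) exp(-1/t)\<close> gives
  \<open>(1/t)^2 (p(1/t) - p'(1/t)) exp(-1/t)\<close>.\<close>

definition flat_step :: "real poly \<Rightarrow> real poly" where
  "flat_step p = [:0, 0, 1:] * (p - pderiv p)"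

lemma poly_exp_tendsto_0: "((\<lambda>x. poly p x * exp (- x)) \<longlongrightarrow> (0::real)) at_top"
proof -
  have "((\<lambda>x. \<Sum>i\<le>degree p. coeff p i * (x ^ i / exp x)) \<longlongrightarrow> (\<Sum>i\<le>degree p. coeff p i * 0)) at_top"
    by (intro tendsto_intros tendsto_power_div_exp_0)
  moreover have "(\<Sum>i\<le>degree p. coeff p i * (x ^ i / exp x)) = poly p x * exp (- x)" for x
    by (simp add: poly_altdef exp_minus sum_distrib_right divide_inverse mult.assoc)
  ultimately show ?thesis by simp
qed

lemma flat_has_derivative: "(flat p has_real_derivative flat (flat_step p) t) (at t)"
proof -
  consider "t < 0" | "t > 0" | "t = 0" by linarith
  then show ?thesis
  proof cases
    case 1
    have "((\<lambda>t. 0) has_real_derivative 0) (at t)" by simp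
    then have "(flat p has_real_derivative 0) (at t)"
      by (rule has_field_derivative_transform_within_open[where S = "{..<0}"])
        (use 1 in \<open>auto simp: flat_def\<close>)
    with 1 show ?thesis by (simp add: flat_def)
  next
    case 2
    have "((\<lambda>t. poly p (1 / t) * exp (- 1 / t)) has_real_derivative flat (flat_step p) t) (at t)"
      using 2 by (auto intro!: derivative_eq_intros DERIV_chain2[OF poly_DERIV]
          simp: flat_def flat_step_def field_simps power2_eq_square)
    then show ?thesis
      by (rule has_field_derivative_transform_within_open[where S = "{0<..}"])
        (use 2 in \<open>auto simp: flat_def\<close>)
  next
    case 3
    \<comment> \<open>At the origin the difference quotient is again of the form
      \<open>flat\<close>, with \<open>p\<close> multiplied by the variable, and the exponential
      beats every polynomial in \<open>1 / h\<close>.\<close>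
    have "((\<lambda>h. poly ([:0, 1:] * p) (inverse h) * exp (- inverse h)) \<longlongrightarrow> 0) (at_right 0)"
      by (rule filterlim_compose[OF poly_exp_tendsto_0 filterlim_inverse_at_top_right])
    then have "((\<lambda>h. flat p h / h) \<longlongrightarrow> 0) (at_right 0)"
      by (rule tendsto_cong[THEN iffD1, rotated])
        (auto simp: eventually_at_filter flat_def field_simps)
    moreover have "((\<lambda>h. flat p h / h) \<longlongrightarrow> 0) (at_left 0)"
      by (rule tendsto_eventually) (auto simp: eventually_at_filter flat_def)
    ultimately have "((\<lambda>h. flat p h / h) \<longlongrightarrow> 0) (at 0)"
      by (simp add: filterlim_split_at)
    with 3 show ?thesis
      by (simp add: DERIV_def flat_def)
  qed
qed

section \<open>Difference quotients and the Laplacian\<close>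

lemma integrable_cpt_support:
  fixes u :: "'a::euclidean_space \<Rightarrow> real"
  assumes "continuous_on UNIV u" and "\<And>x. x \<notin> cball y R \<Longrightarrow> u x = 0"
  shows "integrable lborel u"
proof -
  have "integrable lborel (\<lambda>x. indicator (cball y R) x *\<^sub>R u x)"
    by (rule borel_integrable_compact) (use assms(1) continuous_on_subset in auto)
  also have "(\<lambda>x. indicator (cball y R) x *\<^sub>R u x) = u"
    using assms(2) by (fastforce simp: indicator_def)
  finally show ?thesis .
qed

lemma set_integrable_cball_continuous:
  fixes u :: "'a::euclidean_space \<Rightarrow> real"
  assumes "continuous_on UNIV u"
  shows "set_integrable lborel (cball y R) u"
  unfolding set_integrable_def
  by (rule borel_integrable_compact) (use assms continuous_on_subset in auto)

lemma uniformly_continuous_cball: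
  fixes u :: "'a::euclidean_space \<Rightarrow> real"
  assumes "continuous_on UNIV u" and "e > 0"
  obtains d where "d > 0" "d \<le> 1"
    "\<And>x x'. x \<in> cball y R \<Longrightarrow> dist x x' \<le> d \<Longrightarrow> \<bar>u x - u x'\<bar> \<le> e"
proof -
  have "uniformly_continuous_on (cball y (R + 1)) u"
    by (rule compact_uniformly_continuous) (use assms continuous_on_subset in auto)
  then obtain d where d: "d > 0"
    "\<And>x x'. x \<in> cball y (R + 1) \<Longrightarrow> x' \<in> cball y (R + 1) \<Longrightarrow> dist x' x < d \<Longrightarrow> dist (u x') (u x) < e"
    using assms(2) unfolding uniformly_continuous_on_def by metis
  show ?thesis
  proof (rule that[of "min (d / 2) 1"])
    fix x x' assume *: "x \<in> cball y R" "dist x x' \<le> min (d / 2) 1"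
    then have "x' \<in> cball y (R + 1)"
      using dist_triangle[of y x' x] by auto
    with * d(1) have "dist (u x') (u x) < e"
      by (intro d(2)) (auto simp: dist_commute)
    then show "\<bar>u x - u x'\<bar> \<le> e"
      by (simp add: dist_real_def)
  qed (use d in auto)
qed

lemma uniformly_continuous_cpt_support:
  fixes u :: "'a::euclidean_space \<Rightarrow> real"
  assumes "continuous_on UNIV u" and "\<And>x. x \<notin> cball y R \<Longrightarrow> u x = 0" and "e > 0"
  obtains d where "d > 0" "\<And>x x'. dist x x' \<le> d \<Longrightarrow> \<bar>u x - u x'\<bar> \<le> e"
proof -
  obtain d where d: "d > 0" "d \<le> 1"
    "\<And>x x'. x \<in> cball y R \<Longrightarrow> dist x x' \<le> d \<Longrightarrow> \<bar>u x - u x'\<bar> \<le> e"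
    using uniformly_continuous_cball[OF assms(1,3)] by metis
  show ?thesis
  proof (rule that[OF d(1)])
    fix x x' :: 'a assume *: "dist x x' \<le> d"
    show "\<bar>u x - u x'\<bar> \<le> e"
    proof (cases "x \<in> cball y R \<or> x' \<in> cball y R")
      case True
      then show ?thesis
        using d(3)[of x x'] d(3)[of x' x] * by (auto simp: dist_commute abs_minus_commute)
    qed (use assms in auto)
  qed
qed

lemma bounded_cball_continuous:
  fixes u :: "'a::euclidean_space \<Rightarrow> real"
  assumes "continuous_on UNIV u"
  obtains M where "M > 0" "\<And>x. x \<in> cball y R \<Longrightarrow> \<bar>u x\<bar> \<le> M"
proof -
  have "bounded (u ` cball y R)"
    by (intro compact_imp_bounded compact_continuous_image)
      (use assms continuous_on_subset in auto)
  then show ?thesis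
    using that by (auto simp: bounded_pos)
qed

lemma integral_lborel_translate:
  fixes u :: "'a::euclidean_space \<Rightarrow> real"
  assumes "u \<in> borel_measurable borel"
  shows "(LINT x|lborel. u (c + x)) = (LINT x|lborel. u x)"
proof -
  have "(LINT x|lborel. u (c + x)) = integral\<^sup>L (distr lborel borel ((+) c)) u"
    by (rule integral_distr[symmetric]) (use assms in auto)
  then show ?thesis by (simp add: lborel_distr_plus)
qed

text \<open>The weight \<open>l\<close> is only integrable on \<open>S\<close>, while
  \<open>u\<close> and \<open>v\<close> are uniformly close there. This fits a locally integrable
  potential multiplied by uniformly converging functions, and serves in place of dominated
  convergence for the limits in \<open>h\<close> and \<tau>.\<close>

lemma integral_diff_bound:
  fixes l u v :: "'a::euclidean_space \<Rightarrow> real"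
  assumes l: "set_integrable lborel S l"
    and u: "integrable lborel (\<lambda>x. l x * u x)" and v: "integrable lborel (\<lambda>x. l x * v x)"
    and eq: "\<And>x. x \<notin> S \<Longrightarrow> l x * u x = l x * v x"
    and e: "\<And>x. x \<in> S \<Longrightarrow> \<bar>u x - v x\<bar> \<le> e"
  shows "\<bar>(LINT x|lborel. l x * u x) - (LINT x|lborel. l x * v x)\<bar> \<le> e * (LINT x:S|lborel. \<bar>l x\<bar>)"
proof -
  have "\<bar>(LINT x|lborel. l x * u x) - (LINT x|lborel. l x * v x)\<bar>
      = \<bar>LINT x|lborel. l x * u x - l x * v x\<bar>"
    by (simp add: Bochner_Integration.integral_diff[OF u v])
  also have "\<dots> \<le> (LINT x|lborel. \<bar>l x * u x - l x * v x\<bar>)"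
    by (rule integral_abs_bound)
  also have "\<dots> \<le> (LINT x|lborel. e * (indicator S x *\<^sub>R \<bar>l x\<bar>))"
  proof (rule integral_mono)
    show "integrable lborel (\<lambda>x. \<bar>l x * u x - l x * v x\<bar>)"
      using u v by (intro integrable_abs Bochner_Integration.integrable_diff)
    show "integrable lborel (\<lambda>x. e * (indicator S x *\<^sub>R \<bar>l x\<bar>))"
      using set_integrable_abs[OF l] unfolding set_integrable_def
      by (intro integrable_mult_right) auto
    show "\<bar>l x * u x - l x * v x\<bar> \<le> e * (indicator S x *\<^sub>R \<bar>l x\<bar>)" for x
    proof (cases "x \<in> S")
      case True
      have "\<bar>l x * u x - l x * v x\<bar> = \<bar>u x - v x\<bar> * \<bar>l x\<bar>"
        by (simp add: abs_mult[symmetric] algebra_simps)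
      then show ?thesis using mult_right_mono[OF e[OF True], of "\<bar>l x\<bar>"] True by simp
    qed (simp add: eq)
  qed
  also have "\<dots> = e * (LINT x:S|lborel. \<bar>l x\<bar>)"
    by (simp add: set_lebesgue_integral_def)
  finally show ?thesis .
qed

lemma set_integral_abs_nonneg: "0 \<le> (LINT x:S|M. \<bar>l x::real\<bar>)"
  unfolding set_lebesgue_integral_def by (rule integral_nonneg_AE) auto

lemma integral_tendsto_uniform:
  fixes l v :: "'a::euclidean_space \<Rightarrow> real" and u :: "'b \<Rightarrow> 'a \<Rightarrow> real"
  assumes l: "set_integrable lborel S l"
    and u: "\<forall>\<^sub>F n in F. integrable lborel (\<lambda>x. l x * u n x)"
    and v: "integrable lborel (\<lambda>x. l x * v x)"
    and eq: "\<forall>\<^sub>F n in F. \<forall>x. x \<notin> S \<longrightarrow> l x * u n x = l x * v x"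
    and e: "\<And>e. e > 0 \<Longrightarrow> \<forall>\<^sub>F n in F. \<forall>x\<in>S. \<bar>u n x - v x\<bar> \<le> e"
  shows "((\<lambda>n. LINT x|lborel. l x * u n x) \<longlongrightarrow> (LINT x|lborel. l x * v x)) F"
proof (rule tendstoI)
  fix r :: real assume "r > 0"
  let ?I = "LINT x:S|lborel. \<bar>l x\<bar>"
  have I: "?I \<ge> 0" by (rule set_integral_abs_nonneg)
  \<comment> \<open>The added 1 covers the case \<open>?I = 0\<close> and makes the final inequality
    strict.\<close>
  then have "r / (?I + 1) > 0" using \<open>r > 0\<close> by simp
  from e[OF this] eq u
  show "\<forall>\<^sub>F n in F. dist (LINT x|lborel. l x * u n x) (LINT x|lborel. l x * v x) < r"
  proof eventually_elim
    case (elim n)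
    have "dist (LINT x|lborel. l x * u n x) (LINT x|lborel. l x * v x) \<le> r / (?I + 1) * ?I"
      unfolding dist_real_def by (rule integral_diff_bound[OF l _ v]) (use elim in auto)
    also have "\<dots> < r" using I \<open>r > 0\<close> by (simp add: field_simps)
    finally show ?case .
  qed
qed

section \<open>Locality of derivatives, and second differences as approximate Laplacians\<close>

lemma partial_deriv_zero:
  assumes "closed S" and "\<And>x. x \<notin> S \<Longrightarrow> u x = 0" and "x \<notin> S"
  shows "partial_deriv i u x = 0"
proof -
  have "(u has_derivative (\<lambda>v. 0)) (at x)"
    by (rule has_derivative_transform_within_open[of "\<lambda>x. 0" _ _ _ "- S"]) (use assms in auto)
  from partial_deriv_eq[OF this] show ?thesis .
qed

lemma laplacian_zero:
  assumes "closed S" and "\<And>x. x \<notin> S \<Longrightarrow> u x = 0" and "x \<notin> S"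
  shows "laplacian u x = 0"
  unfolding laplacian_def
  by (intro sum.neutral ballI partial_deriv_zero[OF assms(1) partial_deriv_zero[OF assms(1,2)] assms(3)])
    auto

lemma laplacian_continuous: "C_k 2 u \<Longrightarrow> continuous_on UNIV (laplacian u)"
  unfolding laplacian_def[abs_def] by (intro continuous_on_sum) (simp add: numeral_2_eq_2)

text \<open>The discrete Laplacian along the coordinate axes. As a combination of translations it is
  symmetric under the integral and makes sense for any function, so no derivative of a logarithm is
  ever taken.\<close>

definition sdiff :: "real \<Rightarrow> (real^3 \<Rightarrow> real) \<Rightarrow> real^3 \<Rightarrow> real" where
  "sdiff h u x = (\<Sum>i\<in>Basis. u (x + h *\<^sub>R i) + u (x - h *\<^sub>R i) - 2 * u x) / h\<^sup>2"

lemma sdiff_continuous: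
  assumes "continuous_on UNIV u" shows "continuous_on UNIV (sdiff h u)"
proof -
  have "continuous_on UNIV (\<lambda>x. u (x + c))" for c
    by (rule continuous_on_compose2[OF assms]) (auto intro!: continuous_intros)
  from this this[of "- c" for c] assms show ?thesis
    unfolding sdiff_def[abs_def] divide_inverse by (intro continuous_intros) auto
qed

lemma sdiff_zero:
  assumes "\<And>x. x \<notin> cball y R \<Longrightarrow> u x = 0" and "0 < h" "h \<le> r" and "x \<notin> cball y (R + r)"
  shows "sdiff h u x = 0"
proof -
  have "x + h *\<^sub>R i \<notin> cball y R" "x - h *\<^sub>R i \<notin> cball y R" if "i \<in> Basis" for i
    using that assms(2-4) dist_triangle[of y x "x + h *\<^sub>R i"] dist_triangle[of y x "x - h *\<^sub>R i"]
    by (auto simp: dist_norm)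
  moreover have "x \<notin> cball y R" using assms(2-4) by auto
  ultimately show ?thesis unfolding sdiff_def by (simp add: assms(1))
qed

text \<open>By Taylor's formula each axis quotient is a mean of two values of the pure second
  derivative at points within \<open>h\<close> of \<open>x\<close>. That derivative is uniformly
  continuous because its support is compact, so the convergence is uniform in \<open>x\<close>. Each
  of the three axes receives \<open>e / 3\<close>.\<close>

lemma sdiff_tendsto_laplacian:
  assumes "C_k 2 u" and "\<And>x. x \<notin> cball y R \<Longrightarrow> u x = 0" and "e > 0"
  shows "\<forall>\<^sub>F h in at_right 0. \<forall>x. \<bar>sdiff h u x - laplacian u x\<bar> \<le> e"
proof -
  have "\<forall>\<^sub>F h in at_right 0. \<forall>x. \<bar>(u (x + h *\<^sub>R i) + u (x - h *\<^sub>R i) - 2 * u x) / h\<^sup>2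
      - partial_deriv i (partial_deriv i u) x\<bar> \<le> e / 3" if i: "i \<in> Basis" for i
  proof -
    define P where "P = partial_deriv i u"
    define D where "D = partial_deriv i P"
    have P: "\<And>x. u differentiable (at x)" "\<And>x. P differentiable (at x)" "continuous_on UNIV D"
      using assms(1) i by (auto simp: numeral_2_eq_2 P_def D_def)
    have D0: "x \<notin> cball y R \<Longrightarrow> D x = 0" for x
      unfolding D_def P_def
      by (rule partial_deriv_zero[OF closed_cball partial_deriv_zero[OF closed_cball assms(2)]])
    have line: "((\<lambda>t. w (x + (c * t) *\<^sub>R i)) has_real_derivative c * partial_deriv i w (x + (c * t) *\<^sub>R i)) (at t)"
      if w: "\<And>x. w differentiable (at x)" for w x t c
    proof -
      have "(w has_derivative frechet_derivative w (at (x + (c * t) *\<^sub>R i))) (at (x + (c * t) *\<^sub>R i))"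
        using w frechet_derivative_works by blast
      then have *: "((\<lambda>t. w (x + (c * t) *\<^sub>R i)) has_derivative
          (\<lambda>s. frechet_derivative w (at (x + (c * t) *\<^sub>R i)) ((c * s) *\<^sub>R i))) (at t)"
        by (rule has_derivative_compose[rotated]) (auto intro!: derivative_eq_intros)
      have "linear (frechet_derivative w (at (x + (c * t) *\<^sub>R i)))"
        using w linear_frechet_derivative by blast
      then have "(\<lambda>s. frechet_derivative w (at (x + (c * t) *\<^sub>R i)) ((c * s) *\<^sub>R i))
          = (*) (c * partial_deriv i w (x + (c * t) *\<^sub>R i))"
        by (intro ext) (simp add: linear_scale partial_deriv_def mult_ac)
      with * show ?thesis by (simp only: has_field_derivative_def)
    qed
    obtain d where d: "d > 0" "\<And>x x'. dist x x' \<le> d \<Longrightarrow> \<bar>D x - D x'\<bar> \<le> e / 3"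
      using uniformly_continuous_cpt_support[OF P(3) D0, where e = "e / 3"] assms(3) by auto
    have "\<bar>(u (x + h *\<^sub>R i) + u (x - h *\<^sub>R i) - 2 * u x) / h\<^sup>2 - D x\<bar> \<le> e / 3"
      if h: "0 < h" "h < d" for h x
    proof -
      \<comment> \<open>\<open>df 0\<close> is the even function
        \<open>t \<mapsto> u (x + t i) + u (x - t i)\<close>, and \<open>df 1\<close>,
        \<open>df 2\<close> are its derivatives. Evenness makes \<open>df 1 0\<close> vanish, so the
        Maclaurin formula at \<open>h\<close> leaves exactly the symmetric quotient. The factors 1
        and -1 match the shape of \<open>line\<close>.\<close>
      define df where "df = (\<lambda>m t. if m = 0 then u (x + (1 * t) *\<^sub>R i) + u (x + (-1 * t) *\<^sub>R i)
        else if m = (1::nat) then P (x + (1 * t) *\<^sub>R i) - P (x + (-1 * t) *\<^sub>R i)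
        else D (x + (1 * t) *\<^sub>R i) + D (x + (-1 * t) *\<^sub>R i))"
      have "DERIV (df m) t :> df (Suc m) t" if "m < 2" for m t
      proof -
        consider "m = 0" | "m = 1" using \<open>m < 2\<close> by linarith
        then show ?thesis
        proof cases
          case 1
          show ?thesis unfolding 1
            using DERIV_add[OF line[OF P(1), of x 1 t] line[OF P(1), of x "-1" t]]
            by (simp add: df_def P_def[symmetric])
        next
          case 2
          show ?thesis unfolding 2
            using DERIV_diff[OF line[OF P(2), of x 1 t] line[OF P(2), of x "-1" t]]
            by (simp add: df_def D_def[symmetric] eval_nat_numeral)
        qed
      qed
      then obtain t where t: "0 < t" "t \<le> h"
        "df 0 h = (\<Sum>m<2. df m 0 / fact m * h ^ m) + df 2 t / fact 2 * h ^ 2"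
        using Maclaurin2[of h df "df 0" 2] h by auto
      have eq: "(u (x + h *\<^sub>R i) + u (x - h *\<^sub>R i) - 2 * u x) / h\<^sup>2
          = (D (x + t *\<^sub>R i) + D (x - t *\<^sub>R i)) / 2"
        using t(3) h by (simp add: df_def numeral_2_eq_2 field_simps)
      have "\<bar>D (x + t *\<^sub>R i) - D x\<bar> \<le> e / 3" "\<bar>D (x - t *\<^sub>R i) - D x\<bar> \<le> e / 3"
        by (rule d(2); use t h i in \<open>simp add: dist_norm\<close>)+
      then show ?thesis unfolding eq abs_le_iff by (simp add: field_simps)
    qed
    then show ?thesis unfolding D_def P_def eventually_at_right_field
      using d(1) by (intro exI[of _ d]) auto
  qed
  then have "\<forall>\<^sub>F h in at_right 0. \<forall>i\<in>(Basis::(real^3) set). \<forall>x. \<bar>(u (x + h *\<^sub>R i) + u (x - h *\<^sub>R i) - 2 * u x) / h\<^sup>2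
      - partial_deriv i (partial_deriv i u) x\<bar> \<le> e / 3"
    by (intro eventually_ball_finite) auto
  then show ?thesis
  proof (rule eventually_mono, intro allI)
    fix h :: real and x :: "real^3"
    assume elim: "\<forall>i\<in>Basis. \<forall>x. \<bar>(u (x + h *\<^sub>R i) + u (x - h *\<^sub>R i) - 2 * u x) / h\<^sup>2
      - partial_deriv i (partial_deriv i u) x\<bar> \<le> e / 3"
    have "\<bar>sdiff h u x - laplacian u x\<bar> = \<bar>\<Sum>i\<in>Basis. (u (x + h *\<^sub>R i) + u (x - h *\<^sub>R i) - 2 * u x) / h\<^sup>2
      - partial_deriv i (partial_deriv i u) x\<bar>"
      by (simp only: sdiff_def laplacian_def sum_divide_distrib sum_subtractf[symmetric])
    also have "\<dots> \<le> (\<Sum>i\<in>(Basis::(real^3) set). e / 3)"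
      by (rule order_trans[OF sum_abs sum_mono]) (use elim in auto)
    finally show "\<bar>sdiff h u x - laplacian u x\<bar> \<le> e" by simp
  qed
qed

text \<open>Discrete integration by parts: each translation moves to the other factor by invariance
  of Lebesgue measure and changes its sign, and the shifts by \<open>h\<close> and
  \<open>- h\<close> occur symmetrically. The compact support of \<open>u\<close> makes every
  product integrable.\<close>

lemma integral_sdiff_commute:
  assumes l: "continuous_on UNIV l" and u: "continuous_on UNIV u"
    and supp: "\<And>x. x \<notin> cball y R \<Longrightarrow> u x = 0"
  shows "(LINT x|lborel. l x * sdiff h u x) = (LINT x|lborel. u x * sdiff h l x)"
proof -
  have c: "continuous_on UNIV (\<lambda>x. w (x + a))" if "continuous_on UNIV w" for w :: "real^3 \<Rightarrow> real" and a
    by (rule continuous_on_compose2[OF that]) (auto intro!: continuous_intros)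
  have i: "integrable lborel (\<lambda>x. l (x + a) * u (x + b))" for a b
  proof (rule integrable_cpt_support[of _ "y - b" R])
    show "continuous_on UNIV (\<lambda>x. l (x + a) * u (x + b))"
      by (intro continuous_intros c l u)
    show "l (x + a) * u (x + b) = 0" if "x \<notin> cball (y - b) R" for x
    proof -
      have "dist (y - b) x = dist y (x + b)" by (simp add: dist_norm algebra_simps)
      with that have "x + b \<notin> cball y R" by simp
      then show ?thesis by (simp add: supp)
    qed
  qed
  note i1 = i[of 0, simplified] i[of _ 0, simplified] i[of 0 0, simplified]
    i[of 0 "- b" for b, simplified] i[of "- b" 0 for b, simplified]
  have t: "(LINT x|lborel. l x * u (x + a)) = (LINT x|lborel. l (x - a) * u x)" for a
  proof -
    have "(\<lambda>x. l (x - a) * u x) \<in> borel_measurable borel"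
      using c[OF l, of "- a"] u by (intro borel_measurable_continuous_onI continuous_intros) auto
    from integral_lborel_translate[OF this, of a] show ?thesis by (simp add: add.commute)
  qed
  have t': "(LINT x|lborel. l x * u (x - a)) = (LINT x|lborel. l (x + a) * u x)" for a
    using t[of "- a"] by simp
  have eq: "(LINT x|lborel. (\<Sum>i\<in>Basis. v i x + w i x - 2 * z x) / h\<^sup>2)
      = (\<Sum>i\<in>Basis. (LINT x|lborel. v i x) + (LINT x|lborel. w i x) - 2 * (LINT x|lborel. z x)) / h\<^sup>2"
    if "\<And>i. integrable lborel (v i)" "\<And>i. integrable lborel (w i)" "integrable lborel z"
    for v w :: "real^3 \<Rightarrow> real^3 \<Rightarrow> real" and z
    using that by simp
  have "(LINT x|lborel. l x * sdiff h u x)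
      = (LINT x|lborel. (\<Sum>i\<in>Basis. l x * u (x + h *\<^sub>R i) + l x * u (x - h *\<^sub>R i) - 2 * (l x * u x)) / h\<^sup>2)"
    by (simp add: sdiff_def sum_distrib_left algebra_simps)
  also have "\<dots> = (\<Sum>i\<in>Basis. (LINT x|lborel. l x * u (x + h *\<^sub>R i)) + (LINT x|lborel. l x * u (x - h *\<^sub>R i))
          - 2 * (LINT x|lborel. l x * u x)) / h\<^sup>2"
    by (rule eq) (rule i1)+
  also have "\<dots> = (\<Sum>i\<in>Basis. (LINT x|lborel. l (x - h *\<^sub>R i) * u x) + (LINT x|lborel. l (x + h *\<^sub>R i) * u x)
          - 2 * (LINT x|lborel. l x * u x)) / h\<^sup>2"
    unfolding t t' ..
  also have "\<dots> = (LINT x|lborel. (\<Sum>i\<in>Basis. l (x - h *\<^sub>R i) * u x + l (x + h *\<^sub>R i) * u x - 2 * (l x * u x)) / h\<^sup>2)"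
    by (rule eq[symmetric]) (rule i1)+
  also have "\<dots> = (LINT x|lborel. u x * sdiff h l x)"
    by (simp add: sdiff_def sum_distrib_left algebra_simps)
  finally show ?thesis .
qed

section \<open>Mollification\<close>

lemma flat_continuous: "continuous_on UNIV (flat p)"
  by (intro continuous_at_imp_continuous_on ballI DERIV_isCont[OF flat_has_derivative])

lemma flat_nonneg: "(\<And>t. t > 0 \<Longrightarrow> 0 \<le> poly p (1 / t)) \<Longrightarrow> 0 \<le> flat p t"
  by (simp add: flat_def)

definition bump :: "real \<Rightarrow> real^3 \<Rightarrow> real" where
  "bump \<tau> v = flat 1 (\<tau>\<^sup>2 - v \<bullet> v)"

definition mollifier :: "real \<Rightarrow> real^3 \<Rightarrow> real" where
  "mollifier \<tau> v = bump \<tau> v / (LINT w|lborel. bump \<tau> w)"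

lemma bump_continuous: "continuous_on UNIV (bump \<tau>)"
  unfolding bump_def[abs_def]
  by (intro continuous_on_compose2[OF flat_continuous] continuous_intros) auto

lemma bump_zero: "\<tau> > 0 \<Longrightarrow> v \<notin> cball 0 \<tau> \<Longrightarrow> bump \<tau> v = 0"
  using power_strict_mono[of \<tau> "norm v" 2]
  by (simp add: bump_def flat_def power2_norm_eq_inner)

lemma bump_nonneg: "0 \<le> bump \<tau> v"
  by (simp add: bump_def flat_def)

lemma integral_bump_pos:
  assumes "\<tau> > 0" shows "(LINT w|lborel. bump \<tau> w) > 0"
proof -
  have i: "integrable lborel (bump \<tau>)"
    by (rule integrable_cpt_support[OF bump_continuous bump_zero[OF assms]])
  have p: "w \<in> ball 0 \<tau> \<Longrightarrow> bump \<tau> w > 0" for w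
    using power_strict_mono[of "norm w" \<tau> 2] by (simp add: bump_def flat_def power2_norm_eq_inner)
  have "(LINT w|lborel. bump \<tau> w) \<noteq> 0"
  proof
    assume "(LINT w|lborel. bump \<tau> w) = 0"
    then have "AE w in lborel. bump \<tau> w = 0"
      using integral_nonneg_eq_0_iff_AE[OF i] bump_nonneg by simp
    then have "AE w::real^3 in lborel. w \<notin> ball 0 \<tau>"
      by (rule eventually_mono) (use p in fastforce)
    then have "emeasure lborel (ball (0::real^3) \<tau>) = 0"
      by (subst (asm) AE_iff_measurable[of "ball 0 \<tau>"]) auto
    then have "measure lborel (ball (0::real^3) \<tau>) = 0"
      by (simp add: measure_def)
    then show False using assms by simp
  qed
  moreover have "(LINT w|lborel. bump \<tau> w) \<ge> 0"
    by (intro integral_nonneg_AE) (simp add: bump_nonneg)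
  ultimately show ?thesis by linarith
qed

lemma mollifier_continuous: "continuous_on UNIV (mollifier \<tau>)"
  unfolding mollifier_def[abs_def] divide_inverse by (intro continuous_intros bump_continuous)

lemma mollifier_zero: "\<tau> > 0 \<Longrightarrow> v \<notin> cball 0 \<tau> \<Longrightarrow> mollifier \<tau> v = 0"
  by (simp add: mollifier_def bump_zero)

lemma mollifier_nonneg: "\<tau> > 0 \<Longrightarrow> 0 \<le> mollifier \<tau> v"
  using bump_nonneg[of \<tau> v] integral_bump_pos[of \<tau>] by (simp add: mollifier_def)

text \<open>The m-th derivative of the mollifier as a function of the squared norm. The sign comes
  from the inner function \<open>\<tau>\<^sup>2 - t\<close>, and iterating \<open>flat_step\<close>
  tracks the polynomial.\<close>

definition mollifier_profile :: "real \<Rightarrow> nat \<Rightarrow> real \<Rightarrow> real" where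
  "mollifier_profile \<tau> m t =
     (- 1) ^ m * flat ((flat_step ^^ m) 1) (\<tau>\<^sup>2 - t) / (LINT w|lborel. bump \<tau> w)"

lemma mollifier_eq_profile: "mollifier \<tau> v = mollifier_profile \<tau> 0 (v \<bullet> v)"
  by (simp add: mollifier_def mollifier_profile_def bump_def)

lemma mollifier_profile_derivative:
  "(mollifier_profile \<tau> m has_real_derivative mollifier_profile \<tau> (Suc m) t) (at t)"
proof -
  let ?p = "(flat_step ^^ m) 1"
  have "((\<lambda>t. flat ?p (\<tau>\<^sup>2 - t)) has_real_derivative flat (flat_step ?p) (\<tau>\<^sup>2 - t) * (- 1)) (at t)"
    by (rule DERIV_chain2[OF flat_has_derivative]) (auto intro!: derivative_eq_intros)
  from DERIV_cdivide[OF DERIV_cmult[OF this, of "(- 1) ^ m"], of "LINT w|lborel. bump \<tau> w"]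
  show ?thesis unfolding mollifier_profile_def[abs_def] by simp
qed

lemma C_k_mollifier: "C_k k (\<lambda>z. mollifier \<tau> (z - x))"
  unfolding mollifier_eq_profile
  by (rule C_k_radial)
    (auto intro!: mollifier_profile_derivative continuous_at_imp_continuous_on DERIV_isCont[OF mollifier_profile_derivative])

lemma mollifier_Cc_infinity:
  assumes "\<tau> > 0" shows "(\<lambda>z. mollifier \<tau> (z - x)) \<in> Cc_infinity"
proof -
  have "z - x \<in> cball 0 \<tau>" if "mollifier \<tau> (z - x) \<noteq> 0" for z
    using mollifier_zero[OF assms] that by blast
  then have "{z. mollifier \<tau> (z - x) \<noteq> 0} \<subseteq> cball x \<tau>"
    by (auto simp: dist_norm norm_minus_commute)
  then have "bounded {z. mollifier \<tau> (z - x) \<noteq> 0}"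
    using bounded_subset bounded_cball by blast
  then show ?thesis
    by (simp add: Cc_infinity_def C_k_mollifier)
qed

lemma laplacian_mollifier: "laplacian (\<lambda>z. mollifier \<tau> (z - x)) z = laplacian (mollifier \<tau>) (z - x)"
  using laplacian_radial[OF mollifier_profile_derivative[where m = 0 and \<tau> = \<tau>] mollifier_profile_derivative[where m = "Suc 0" and \<tau> = \<tau>], of x z]
    laplacian_radial[OF mollifier_profile_derivative[where m = 0 and \<tau> = \<tau>] mollifier_profile_derivative[where m = "Suc 0" and \<tau> = \<tau>], of 0 "z - x"]
  by (simp add: mollifier_eq_profile[abs_def])

text \<open>The kernels are even, so that \<open>conv\<close> is the convolution.\<close>

definition conv :: "(real^3 \<Rightarrow> real) \<Rightarrow> (real^3 \<Rightarrow> real) \<Rightarrow> real^3 \<Rightarrow> real" where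
  "conv f k x = (LINT z|lborel. f z * k (z - x))"

lemma borel_continuous: "continuous_on UNIV f \<Longrightarrow> f \<in> borel_measurable borel"
  by (rule borel_measurable_continuous_onI)

lemma continuous_translate:
  fixes u :: "'a::real_normed_vector \<Rightarrow> 'b::topological_space"
  assumes "continuous_on UNIV u"
  shows "continuous_on UNIV (\<lambda>x. u (x + c))" "continuous_on UNIV (\<lambda>x. u (c + x))"
    "continuous_on UNIV (\<lambda>x. u (x - c))"
  by (rule continuous_on_compose2[OF assms]; auto intro!: continuous_intros)+

lemma set_integrable_subset_borel:
  assumes "integrable lborel k" "S \<in> sets borel"
  shows "set_integrable lborel S (k :: 'a::euclidean_space \<Rightarrow> real)"
  unfolding set_integrable_def using integrable_mult_indicator[of S lborel k] assms by simp

lemma integrable_mult_continuous: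
  fixes k f :: "'a::euclidean_space \<Rightarrow> real"
  assumes k: "integrable lborel k" and supp: "\<And>x. x \<notin> cball y R \<Longrightarrow> k x = 0"
    and f: "continuous_on UNIV f"
  shows "integrable lborel (\<lambda>x. k x * f x)"
proof -
  obtain M where M: "\<And>x. x \<in> cball y R \<Longrightarrow> \<bar>f x\<bar> \<le> M"
    using bounded_cball_continuous[OF f] by metis
  show ?thesis
  proof (rule Bochner_Integration.integrable_bound)
    show "integrable lborel (\<lambda>x. M * k x)"
      using k by (rule integrable_mult_right)
    show "(\<lambda>x. k x * f x) \<in> borel_measurable lborel"
      using borel_measurable_integrable[OF k] borel_continuous[OF f] by simp
    have "norm (k x * f x) \<le> norm (M * k x)" for x
    proof (cases "x \<in> cball y R")
      case True
      with M[OF True] mult_right_mono[of "\<bar>f x\<bar>" "\<bar>M\<bar>" "\<bar>k x\<bar>"] show ?thesis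
        by (simp add: abs_mult mult.commute)
    qed (simp add: supp)
    then show "AE x in lborel. norm (k x * f x) \<le> norm (M * k x)"
      by simp
  qed
qed

lemma integrable_mult_cpt_support:
  fixes W u :: "'a::euclidean_space \<Rightarrow> real"
  assumes "set_integrable lborel (cball y R) W"
    and "continuous_on UNIV u" and "\<And>x. x \<notin> cball y R \<Longrightarrow> u x = 0"
  shows "integrable lborel (\<lambda>x. W x * u x)"
proof -
  have "integrable lborel (\<lambda>x. (indicator (cball y R) x *\<^sub>R W x) * u x)"
    by (rule integrable_mult_continuous[of _ y R])
      (use assms in \<open>auto simp: set_integrable_def\<close>)
  also have "(\<lambda>x. (indicator (cball y R) x *\<^sub>R W x) * u x) = (\<lambda>x. W x * u x)"
    using assms(3) by (fastforce simp: indicator_def)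
  finally show ?thesis .
qed

lemma translate_zero:
  fixes u :: "'a::real_normed_vector \<Rightarrow> real"
  assumes "\<And>x. x \<notin> cball 0 r \<Longrightarrow> u x = 0"
  shows "z \<notin> cball x r \<Longrightarrow> u (z - x) = 0"
  by (rule assms) (simp add: dist_norm norm_minus_commute)

text \<open>The kernel \<open>k\<close> may be unbounded here, e.g. a truncated Newtonian kernel.\<close>

lemma integral_kernel_continuous:
  fixes f k :: "'a::euclidean_space \<Rightarrow> real"
  assumes f: "continuous_on UNIV f" and k: "integrable lborel k"
    and supp: "\<And>z. z \<notin> cball 0 r \<Longrightarrow> k z = 0"
  shows "continuous_on UNIV (\<lambda>x. LINT z|lborel. k z * f (x + z))"
proof -
  have i: "integrable lborel (\<lambda>z. k z * f (x + z))" for x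
    by (rule integrable_mult_continuous[OF k supp continuous_translate(2)[OF f]])
  let ?I = "LINT z:cball 0 r|lborel. \<bar>k z\<bar>"
  have I: "?I \<ge> 0" by (rule set_integral_abs_nonneg)
  show ?thesis
    unfolding continuous_on_iff
  proof (intro ballI allI impI)
    fix x and e :: real assume "e > 0"
    with I have e: "e / (?I + 1) > 0" by simp
    obtain d where d: "d > 0"
      "\<And>a b. a \<in> cball x r \<Longrightarrow> dist a b \<le> d \<Longrightarrow> \<bar>f a - f b\<bar> \<le> e / (?I + 1)"
      using uniformly_continuous_cball[OF f e] by metis
    show "\<exists>d>0. \<forall>x'\<in>UNIV. dist x' x < d \<longrightarrow>
      dist (LINT z|lborel. k z * f (x' + z)) (LINT z|lborel. k z * f (x + z)) < e"
    proof (intro exI[of _ d] conjI d(1) ballI impI)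
      fix x' assume x': "dist x' x < d"
      have "\<bar>(LINT z|lborel. k z * f (x + z)) - (LINT z|lborel. k z * f (x' + z))\<bar> \<le> e / (?I + 1) * ?I"
      proof (rule integral_diff_bound[OF set_integrable_subset_borel[OF k] i i])
        fix z assume "z \<in> cball (0::'a) r"
        then show "\<bar>f (x + z) - f (x' + z)\<bar> \<le> e / (?I + 1)"
          by (intro d(2)) (use x' in \<open>auto simp: dist_norm norm_minus_commute\<close>)
      qed (auto simp: supp)
      also have "\<dots> < e" using I \<open>e > 0\<close> by (simp add: field_simps)
      finally show "dist (LINT z|lborel. k z * f (x' + z)) (LINT z|lborel. k z * f (x + z)) < e"
        by (simp add: dist_real_def abs_minus_commute)
    qed
  qed
qed

text \<open>All regularity comes from the kernel, since \<open>W\<close> is merely locally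
  integrable: a continuous kernel of compact support is uniformly continuous.\<close>

lemma conv_continuous:
  assumes W: "\<And>y R. set_integrable lborel (cball y R) W"
    and k: "continuous_on UNIV k" and supp: "\<And>z. z \<notin> cball 0 r \<Longrightarrow> k z = 0"
  shows "continuous_on UNIV (conv W k)"
  unfolding continuous_on_iff
proof (intro ballI allI impI)
  fix x and e :: real assume "e > 0"
  have i: "integrable lborel (\<lambda>z. W z * k (z - x))" for x
    by (rule integrable_mult_cpt_support[OF W[of x r] continuous_translate(3)[OF k]])
      (rule translate_zero[of r], rule supp)
  \<comment> \<open>For \<open>x'\<close> within distance 1 of \<open>x\<close>, both translated
    kernels are supported in this enlarged ball.\<close>
  let ?I = "LINT z:cball x (r + 1)|lborel. \<bar>W z\<bar>"
  have I: "?I \<ge> 0" by (rule set_integral_abs_nonneg)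
  with \<open>e > 0\<close> have e: "e / (?I + 1) > 0" by simp
  obtain d where d: "d > 0"
    "\<And>a b. dist a b \<le> d \<Longrightarrow> \<bar>k a - k b\<bar> \<le> e / (?I + 1)"
    using uniformly_continuous_cpt_support[OF k supp e] by metis
  show "\<exists>d>0. \<forall>x'\<in>UNIV. dist x' x < d \<longrightarrow> dist (conv W k x') (conv W k x) < e"
  proof (intro exI[of _ "min d 1"] conjI ballI impI)
    fix x' assume x': "dist x' x < min d 1"
    have "\<bar>(LINT z|lborel. W z * k (z - x)) - (LINT z|lborel. W z * k (z - x'))\<bar> \<le> e / (?I + 1) * ?I"
    proof (rule integral_diff_bound[OF W i i])
      show "\<bar>k (z - x) - k (z - x')\<bar> \<le> e / (?I + 1)" for z
        by (intro d(2)) (use x' in \<open>auto simp: dist_norm\<close>)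
      fix z assume z: "z \<notin> cball x (r + 1)"
      then have "z \<notin> cball x r" "z \<notin> cball x' r"
        using x' dist_triangle[of x z x'] by (auto simp: dist_commute)
      then have "k (z - x) = 0" "k (z - x') = 0"
        using translate_zero[of r k, OF supp] by blast+
      then show "W z * k (z - x) = W z * k (z - x')" by simp
    qed
    also have "\<dots> < e" using I \<open>e > 0\<close> by (simp add: field_simps)
    finally show "dist (conv W k x') (conv W k x) < e"
      by (simp add: dist_real_def abs_minus_commute conv_def)
  qed (use d in auto)
qed

lemma integral_mollifier:
  assumes "\<tau> > 0" shows "(LINT z|lborel. mollifier \<tau> (z - x)) = 1"
proof -
  have "(LINT z|lborel. mollifier \<tau> (z - x)) = (LINT z|lborel. mollifier \<tau> (x + z - x))"
    by (rule integral_lborel_translate[symmetric])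
      (intro borel_continuous continuous_translate mollifier_continuous)
  also have "\<dots> = 1"
    using integral_bump_pos[OF assms] by (simp add: mollifier_def)
  finally show ?thesis .
qed

text \<open>The mollifier is nonnegative with total mass one, so the difference is a weighted mean
  of \<open>g z - g x\<close> over the ball of radius \<tau>.\<close>

lemma conv_mollifier_bound:
  assumes g: "continuous_on UNIV g" and \<tau>: "\<tau> > 0"
    and e: "\<And>z. z \<in> cball x \<tau> \<Longrightarrow> \<bar>g z - g x\<bar> \<le> e"
  shows "\<bar>conv g (mollifier \<tau>) x - g x\<bar> \<le> e"
proof -
  let ?k = "\<lambda>z. mollifier \<tau> (z - x)"
  have k: "continuous_on UNIV ?k" by (intro continuous_translate mollifier_continuous)
  have k0: "z \<notin> cball x \<tau> \<Longrightarrow> ?k z = 0" for z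
    by (rule translate_zero[OF mollifier_zero[OF \<tau>]])
  have ik: "integrable lborel ?k" by (rule integrable_cpt_support[OF k k0])
  have "\<bar>(LINT z|lborel. ?k z * g z) - (LINT z|lborel. ?k z * g x)\<bar> \<le> e * (LINT z:cball x \<tau>|lborel. \<bar>?k z\<bar>)"
    by (rule integral_diff_bound[OF set_integrable_subset_borel[OF ik]])
      (use integrable_mult_continuous[OF ik k0 g] ik k0 e in auto)
  moreover have "(LINT z:cball x \<tau>|lborel. \<bar>?k z\<bar>) = (LINT z|lborel. ?k z)"
    unfolding set_lebesgue_integral_def
    by (rule Bochner_Integration.integral_cong)
      (use k0 mollifier_nonneg[OF \<tau>] in \<open>auto simp: indicator_def\<close>)
  ultimately show ?thesis
    by (simp add: conv_def integral_mollifier[OF \<tau>] mult.commute)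
qed

lemma sdiff_conv:
  assumes f: "continuous_on UNIV f" and k: "continuous_on UNIV k"
    and supp: "\<And>z. z \<notin> cball 0 r \<Longrightarrow> k z = 0"
  shows "sdiff h (conv f k) x = conv f (sdiff h k) x"
proof -
  have i: "integrable lborel (\<lambda>z. f z * k (z - x))" for x
    by (rule integrable_mult_cpt_support[OF set_integrable_cball_continuous[OF f, of x r]
          continuous_translate(3)[OF k]]) (rule translate_zero[of r], rule supp)
  have "conv f (sdiff h k) x = (LINT z|lborel. (\<Sum>j\<in>Basis. f z * k (z - (x - h *\<^sub>R j))
      + f z * k (z - (x + h *\<^sub>R j)) - 2 * (f z * k (z - x))) / h\<^sup>2)"
    by (simp add: conv_def sdiff_def sum_distrib_left algebra_simps)
  also have "\<dots> = (\<Sum>j\<in>Basis. conv f k (x - h *\<^sub>R j) + conv f k (x + h *\<^sub>R j) - 2 * conv f k x) / h\<^sup>2"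
    unfolding conv_def by (simp add: i)
  also have "\<dots> = sdiff h (conv f k) x"
    by (simp add: sdiff_def add.commute)
  finally show ?thesis ..
qed

section \<open>The logarithm of a supersolution\<close>

lemma conv_nonneg:
  assumes "\<And>x. 0 \<le> f x" "\<And>x. 0 \<le> k x" shows "0 \<le> conv f k x"
  unfolding conv_def by (rule integral_nonneg_AE) (simp add: assms)

lemma continuous_ln_quotient:
  assumes "continuous_on UNIV F" "\<And>x. 0 \<le> F x" "\<epsilon> > (0::real)"
  shows "continuous_on UNIV (\<lambda>x. ln ((F x + \<epsilon>) / \<epsilon>))"
  using assms by (intro continuous_intros) (auto simp: add_nonneg_eq_0_iff)

lemma continuous_on_quotient_pos:
  fixes F G :: "'a::topological_space \<Rightarrow> real"
  assumes "continuous_on UNIV G" "continuous_on UNIV F" and "\<And>x. F x + c > 0"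
  shows "continuous_on UNIV (\<lambda>x. G x / (F x + c))"
proof (rule continuous_on_divide[OF assms(1) continuous_on_add[OF assms(2) continuous_on_const]])
  show "\<forall>x\<in>UNIV. F x + c \<noteq> 0" using assms(3) by (metis less_irrefl)
qed

text \<open>The tangent of \<open>ln\<close> at the central value serves both neighbours, so the
  denominators agree and the increments of \<open>F\<close> add up to a second difference.\<close>

lemma sdiff_ln_le:
  assumes F: "\<And>x. 0 \<le> F x" and \<epsilon>: "\<epsilon> > 0"
  shows "sdiff h (\<lambda>x. ln ((F x + \<epsilon>) / \<epsilon>)) x \<le> sdiff h F x / (F x + \<epsilon>)"
proof -
  let ?l = "\<lambda>x. ln ((F x + \<epsilon>) / \<epsilon>)"
  have pos: "F z + \<epsilon> > 0" for z using F[of z] \<epsilon> by linarith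
  have "?l z - ?l x \<le> (F z - F x) / (F x + \<epsilon>)" for z
  proof -
    have "?l z - ?l x = ln ((F z + \<epsilon>) / (F x + \<epsilon>))"
      using pos[of z] pos[of x] \<epsilon> by (simp add: ln_div)
    also have "\<dots> \<le> (F z + \<epsilon>) / (F x + \<epsilon>) - 1"
      by (rule ln_le_minus_one) (use pos in simp)
    also have "\<dots> = (F z - F x) / (F x + \<epsilon>)"
      using pos[of x] by (simp add: field_simps)
    finally show ?thesis .
  qed
  from add_mono[OF this this]
  have "?l a + ?l b - 2 * ?l x \<le> (F a + F b - 2 * F x) / (F x + \<epsilon>)" for a b
    by (simp add: add_divide_distrib[symmetric] algebra_simps)
  then have "(\<Sum>i\<in>Basis. ?l (x + h *\<^sub>R i) + ?l (x - h *\<^sub>R i) - 2 * ?l x)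
      \<le> (\<Sum>i\<in>Basis. F (x + h *\<^sub>R i) + F (x - h *\<^sub>R i) - 2 * F x) / (F x + \<epsilon>)"
    unfolding sum_divide_distrib by (rule sum_mono)
  from divide_right_mono[OF this, of "h\<^sup>2"] show ?thesis
    by (simp add: sdiff_def mult.commute)
qed

text \<open>The second difference is moved from the convolution onto the smooth kernel, where
  uniform convergence to the Laplacian is known; \<open>f\<close> then enters only through its
  integral over a ball.\<close>

lemma sdiff_conv_tendsto:
  assumes f: "continuous_on UNIV f" and k: "C_k 2 k"
    and supp: "\<And>z. z \<notin> cball 0 r \<Longrightarrow> k z = 0" and e: "e > 0"
  shows "\<forall>\<^sub>F h in at_right 0. \<forall>x\<in>cball y R. \<bar>sdiff h (conv f k) x - conv f (laplacian k) x\<bar> \<le> e"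
proof -
  let ?B = "cball y (R + r + 1)"
  let ?I = "LINT z:?B|lborel. \<bar>f z\<bar>"
  have I: "?I \<ge> 0" by (rule set_integral_abs_nonneg)
  with e have e': "e / (?I + 1) > 0" by simp
  have kc: "continuous_on UNIV k" using C_k_imp_continuous[OF k] .
  note fi = set_integrable_cball_continuous[OF f]
  have "\<forall>\<^sub>F h::real in at_right 0. 0 < h \<and> h < 1"
    unfolding eventually_at_right_field by (intro exI[of _ 1]) auto
  moreover have "\<forall>\<^sub>F h in at_right 0. \<forall>x. \<bar>sdiff h k x - laplacian k x\<bar> \<le> e / (?I + 1)"
    by (rule sdiff_tendsto_laplacian[OF k supp e'])
  ultimately show ?thesis
  proof eventually_elim
    case (elim h)
    show ?case
    proof
      fix x assume x: "x \<in> cball y R"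
      have eq: "sdiff h (conv f k) x = conv f (sdiff h k) x"
        by (rule sdiff_conv[OF f kc supp])
      have s0: "sdiff h k z = 0" if "z \<notin> cball 0 (r + 1)" for z
        by (rule sdiff_zero[of 0 r k h 1]) (use supp elim that in auto)
      have l0: "laplacian k z = 0" if "z \<notin> cball 0 (r + 1)" for z
        by (rule laplacian_zero[of "cball 0 r"]) (use supp that in auto)
      have B: "z \<notin> cball x (r + 1)" if "z \<notin> ?B" for z
        using x that dist_triangle[of y z x] by auto
      have "\<bar>(LINT z|lborel. f z * sdiff h k (z - x)) - (LINT z|lborel. f z * laplacian k (z - x))\<bar>
          \<le> e / (?I + 1) * ?I"
      proof (rule integral_diff_bound[OF fi])
        show "integrable lborel (\<lambda>z. f z * sdiff h k (z - x))"
          by (rule integrable_mult_cpt_support[OF fi[of x "r + 1"] continuous_translate(3)[OF sdiff_continuous[OF kc]]])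
            (rule translate_zero[of "r + 1"], rule s0)
        show "integrable lborel (\<lambda>z. f z * laplacian k (z - x))"
          by (rule integrable_mult_cpt_support[OF fi[of x "r + 1"] continuous_translate(3)[OF laplacian_continuous[OF k]]])
            (rule translate_zero[of "r + 1"], rule l0)
        show "f z * sdiff h k (z - x) = f z * laplacian k (z - x)" if "z \<notin> ?B" for z
          using translate_zero[of "r + 1" "sdiff h k" z x] translate_zero[of "r + 1" "laplacian k" z x]
            s0 l0 B[OF that] by simp
        show "\<bar>sdiff h k (z - x) - laplacian k (z - x)\<bar> \<le> e / (?I + 1)" for z
          using elim by blast
      qed
      also have "\<dots> \<le> e" using I e by (simp add: field_simps)
      finally show "\<bar>sdiff h (conv f k) x - conv f (laplacian k) x\<bar> \<le> e"
        by (simp only: eq) (simp add: conv_def)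
    qed
  qed
qed

lemma integral_sdiff_tendsto:
  assumes lc: "continuous_on UNIV l" and \<psi>: "C_k 2 \<psi>"
    and supp: "\<And>x. x \<notin> cball y R \<Longrightarrow> \<psi> x = 0"
  shows "((\<lambda>h. LINT x|lborel. l x * sdiff h \<psi> x) \<longlongrightarrow> (LINT x|lborel. l x * laplacian \<psi> x)) (at_right 0)"
proof (rule integral_tendsto_uniform[of "cball y (R + 1)"])
  have small: "\<forall>\<^sub>F h::real in at_right 0. 0 < h \<and> h < 1"
    unfolding eventually_at_right_field by (intro exI[of _ 1]) auto
  have s0: "sdiff h \<psi> x = 0" if "0 < h" "h < 1" "x \<notin> cball y (R + 1)" for h x
    by (rule sdiff_zero[OF supp]) (use that in auto)
  have l0: "laplacian \<psi> x = 0" if "x \<notin> cball y (R + 1)" for x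
    by (rule laplacian_zero[of "cball y R"]) (use supp that in auto)
  show "set_integrable lborel (cball y (R + 1)) l" by (rule set_integrable_cball_continuous[OF lc])
  have i: "integrable lborel (\<lambda>x. l x * sdiff h \<psi> x)" if "0 < h" for h
    by (rule integrable_mult_cpt_support[OF set_integrable_cball_continuous[OF lc]
          sdiff_continuous[OF C_k_imp_continuous[OF \<psi>]]])
      (rule sdiff_zero[OF supp \<open>0 < h\<close> order_refl])
  show "\<forall>\<^sub>F h in at_right 0. integrable lborel (\<lambda>x. l x * sdiff h \<psi> x)"
    using small by (rule eventually_mono) (use i in blast)
  show "integrable lborel (\<lambda>x. l x * laplacian \<psi> x)"
    by (rule integrable_mult_cpt_support[OF set_integrable_cball_continuous[OF lc] laplacian_continuous[OF \<psi>]])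
      (rule l0)
  show "\<forall>\<^sub>F h in at_right 0. \<forall>x. x \<notin> cball y (R + 1) \<longrightarrow> l x * sdiff h \<psi> x = l x * laplacian \<psi> x"
    using small by (rule eventually_mono) (use s0 l0 in auto)
  show "\<forall>\<^sub>F h in at_right 0. \<forall>x\<in>cball y (R + 1). \<bar>sdiff h \<psi> x - laplacian \<psi> x\<bar> \<le> e"
    if "e > 0" for e
    by (rule eventually_mono[OF sdiff_tendsto_laplacian[OF \<psi> supp that]]) auto
qed

text \<open>Discrete integration by parts against the constant 1, whose second differences
  vanish.\<close>

lemma integral_laplacian_eq_0:
  assumes \<psi>: "C_k 2 \<psi>" and supp: "\<And>x. x \<notin> cball y R \<Longrightarrow> \<psi> x = 0"
  shows "(LINT x|lborel. laplacian \<psi> x) = 0"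
proof -
  have "(LINT x|lborel. 1 * sdiff h \<psi> x) = 0" for h
    by (subst integral_sdiff_commute[OF continuous_on_const C_k_imp_continuous[OF \<psi>] supp])
      (simp_all add: sdiff_def)
  moreover have "((\<lambda>h. LINT x|lborel. 1 * sdiff h \<psi> x) \<longlongrightarrow> (LINT x|lborel. 1 * laplacian \<psi> x)) (at_right 0)"
    by (rule integral_sdiff_tendsto[OF continuous_on_const \<psi> supp])
  ultimately show ?thesis
    using tendsto_unique[of "at_right (0::real)"] by (metis (no_types, lifting) mult_1 tendsto_const tendsto_cong trivial_limit_at_right_real ext)
qed

text \<open>The distributional inequality \<open>\<Delta>f \<le> W f\<close> with a nonnegative
  Borel \<open>W\<close>. Integrals are over \<open>lborel\<close>, where Fubini and translation
  invariance are applied.\<close>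

locale supersolution =
  fixes f W :: "real^3 \<Rightarrow> real"
  assumes f_continuous: "continuous_on UNIV f" and f_nonneg: "0 \<le> f x"
    and W_measurable: "W \<in> borel_measurable borel" and W_nonneg: "0 \<le> W x"
    and W_integrable: "set_integrable lborel (cball y R) W"
    and test: "\<phi> \<in> Cc_infinity \<Longrightarrow> (\<And>x. 0 \<le> \<phi> x) \<Longrightarrow>
      (LINT x|lborel. f x * laplacian \<phi> x) \<le> (LINT x|lborel. W x * (f x * \<phi> x))"
begin

abbreviation mollified :: "real \<Rightarrow> real^3 \<Rightarrow> real" where
  "mollified \<tau> \<equiv> conv f (mollifier \<tau>)"

lemma mollified_continuous: "\<tau> > 0 \<Longrightarrow> continuous_on UNIV (mollified \<tau>)"
  by (rule conv_continuous[OF set_integrable_cball_continuous[OF f_continuous] mollifier_continuous])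
    (rule mollifier_zero)

lemma mollified_nonneg: "\<tau> > 0 \<Longrightarrow> 0 \<le> mollified \<tau> x"
  by (simp add: conv_nonneg f_nonneg mollifier_nonneg)

lemma C_2_mollifier: "C_k 2 (mollifier \<tau>)"
  using C_k_mollifier[of 2 \<tau> 0] by simp

lemma laplacian_mollified_continuous:
  assumes "\<tau> > 0" shows "continuous_on UNIV (conv f (laplacian (mollifier \<tau>)))"
  by (rule conv_continuous[OF set_integrable_cball_continuous[OF f_continuous]
        laplacian_continuous[OF C_2_mollifier], of \<tau>])
    (rule laplacian_zero[OF closed_cball mollifier_zero[OF assms]])

text \<open>An integrated form of \<open>\<Delta> ln (F + \<epsilon>) \<le> \<Delta>F / (F +
  \<epsilon>)\<close> for the mollification \<open>F\<close>. For fixed \<open>h\<close> the second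
  difference passes from \<psi> to the logarithm and, by concavity, to \<open>F\<close>. As
  \<open>h\<close> tends to 0, the left side converges because \<psi> is C^2, the right side because
  the mollifier is.\<close>

lemma integral_ln_mollified:
  assumes \<tau>: "\<tau> > 0" and \<epsilon>: "\<epsilon> > 0" and \<psi>: "C_k 2 \<psi>"
    and supp: "\<And>x. x \<notin> cball y R \<Longrightarrow> \<psi> x = 0" and \<psi>_nonneg: "\<And>x. 0 \<le> \<psi> x"
  shows "(LINT x|lborel. ln ((mollified \<tau> x + \<epsilon>) / \<epsilon>) * laplacian \<psi> x)
    \<le> (LINT x|lborel. \<psi> x / (mollified \<tau> x + \<epsilon>) * conv f (laplacian (mollifier \<tau>)) x)"
proof (rule tendsto_le)
  let ?F = "mollified \<tau>"
  let ?l = "\<lambda>x. ln ((?F x + \<epsilon>) / \<epsilon>)"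
  let ?\<chi> = "\<lambda>x. \<psi> x / (?F x + \<epsilon>)"
  note Fc = mollified_continuous[OF \<tau>]
  have lc: "continuous_on UNIV ?l"
    by (rule continuous_ln_quotient[OF Fc mollified_nonneg[OF \<tau>] \<epsilon>])
  have \<psi>c: "continuous_on UNIV \<psi>" using C_k_imp_continuous[OF \<psi>] .
  have pos: "?F x + \<epsilon> > 0" for x using mollified_nonneg[OF \<tau>, of x] \<epsilon> by linarith
  have \<chi>c: "continuous_on UNIV ?\<chi>"
    by (rule continuous_on_quotient_pos[OF \<psi>c Fc pos])
  have \<chi>0: "x \<notin> cball y R \<Longrightarrow> ?\<chi> x = 0" for x by (simp add: supp)
  show "((\<lambda>h. LINT x|lborel. ?l x * sdiff h \<psi> x) \<longlongrightarrow> (LINT x|lborel. ?l x * laplacian \<psi> x)) (at_right 0)"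
    by (rule integral_sdiff_tendsto[OF lc \<psi> supp])
  show "((\<lambda>h. LINT x|lborel. ?\<chi> x * sdiff h ?F x)
      \<longlongrightarrow> (LINT x|lborel. ?\<chi> x * conv f (laplacian (mollifier \<tau>)) x)) (at_right 0)"
  proof (rule integral_tendsto_uniform[of "cball y R"])
    show "set_integrable lborel (cball y R) ?\<chi>" by (rule set_integrable_cball_continuous[OF \<chi>c])
    show "\<forall>\<^sub>F h in at_right 0. integrable lborel (\<lambda>x. ?\<chi> x * sdiff h ?F x)"
      by (rule always_eventually, rule allI, rule integrable_cpt_support[of _ y R]) (rule continuous_on_mult[OF \<chi>c sdiff_continuous[OF Fc]], simp add: supp)
    show "integrable lborel (\<lambda>x. ?\<chi> x * conv f (laplacian (mollifier \<tau>)) x)"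
      by (rule integrable_cpt_support[of _ y R])
        (rule continuous_on_mult[OF \<chi>c laplacian_mollified_continuous[OF \<tau>]], simp add: supp)
    show "\<forall>\<^sub>F h in at_right 0. \<forall>x. x \<notin> cball y R \<longrightarrow>
        ?\<chi> x * sdiff h ?F x = ?\<chi> x * conv f (laplacian (mollifier \<tau>)) x"
      by (simp add: supp)
    show "\<forall>\<^sub>F h in at_right 0. \<forall>x\<in>cball y R. \<bar>sdiff h ?F x - conv f (laplacian (mollifier \<tau>)) x\<bar> \<le> e"
      if "e > 0" for e
      by (rule sdiff_conv_tendsto[OF f_continuous C_2_mollifier mollifier_zero[OF \<tau>] that])
  qed
  show "\<forall>\<^sub>F h in at_right 0. (LINT x|lborel. ?l x * sdiff h \<psi> x) \<le> (LINT x|lborel. ?\<chi> x * sdiff h ?F x)"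
  proof (rule always_eventually, rule allI)
    fix h
    have "(LINT x|lborel. ?l x * sdiff h \<psi> x) = (LINT x|lborel. \<psi> x * sdiff h ?l x)"
      by (rule integral_sdiff_commute[OF lc \<psi>c supp])
    also have "\<dots> \<le> (LINT x|lborel. ?\<chi> x * sdiff h ?F x)"
    proof (rule integral_mono)
      show "integrable lborel (\<lambda>x. \<psi> x * sdiff h ?l x)"
        by (rule integrable_cpt_support[of _ y R]) (auto intro!: continuous_intros \<psi>c sdiff_continuous lc simp: supp)
      show "integrable lborel (\<lambda>x. ?\<chi> x * sdiff h ?F x)"
        by (rule integrable_cpt_support[of _ y R]) (rule continuous_on_mult[OF \<chi>c sdiff_continuous[OF Fc]], simp add: supp)
      show "\<psi> x * sdiff h ?l x \<le> ?\<chi> x * sdiff h ?F x" for x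
        using mult_left_mono[OF sdiff_ln_le[OF mollified_nonneg[OF \<tau>] \<epsilon>] \<psi>_nonneg] by simp
    qed
    finally show "(LINT x|lborel. ?l x * sdiff h \<psi> x) \<le> (LINT x|lborel. ?\<chi> x * sdiff h ?F x)" .
  qed
qed simp

lemma integrable_W_mult:
  assumes "continuous_on UNIV u" "\<And>x. x \<notin> cball y R \<Longrightarrow> u x = 0"
  shows "integrable lborel (\<lambda>x. W x * u x)"
  by (rule integrable_mult_cpt_support[OF W_integrable assms])

text \<open>Here the hypothesis \<open>test\<close> is applied, with a translated mollifier. As the
  mollifier lives on the ball of radius \<tau>, the factor \<open>f\<close> can be replaced by its
  bound \<open>c\<close> there.\<close>

lemma conv_laplacian_mollifier_le:
  assumes \<tau>: "\<tau> > 0" and le: "\<And>z. z \<in> cball x \<tau> \<Longrightarrow> f z \<le> c"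
  shows "conv f (laplacian (mollifier \<tau>)) x \<le> c * conv W (mollifier \<tau>) x"
proof -
  let ?k = "\<lambda>z. mollifier \<tau> (z - x)"
  have kc: "continuous_on UNIV ?k" by (intro continuous_translate mollifier_continuous)
  have k0: "z \<notin> cball x \<tau> \<Longrightarrow> ?k z = 0" for z
    by (rule translate_zero[OF mollifier_zero[OF \<tau>]])
  have "conv f (laplacian (mollifier \<tau>)) x = (LINT z|lborel. f z * laplacian ?k z)"
    by (simp add: conv_def laplacian_mollifier)
  also have "\<dots> \<le> (LINT z|lborel. W z * (f z * ?k z))"
    by (rule test[OF mollifier_Cc_infinity[OF \<tau>] mollifier_nonneg[OF \<tau>]])
  also have "\<dots> \<le> (LINT z|lborel. c * (W z * ?k z))"
  proof (rule integral_mono)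
    show "integrable lborel (\<lambda>z. W z * (f z * ?k z))"
      by (rule integrable_W_mult[of _ x \<tau>]) (auto intro!: continuous_intros f_continuous kc simp: k0)
    show "integrable lborel (\<lambda>z. c * (W z * ?k z))"
      by (intro integrable_mult_right integrable_W_mult[of _ x \<tau>] kc k0)
    show "W z * (f z * ?k z) \<le> c * (W z * ?k z)" for z
    proof (cases "z \<in> cball x \<tau>")
      case True
      have "f z * (W z * ?k z) \<le> c * (W z * ?k z)"
        using le[OF True] W_nonneg[of z] mollifier_nonneg[OF \<tau>, of "z - x"]
        by (intro mult_right_mono) auto
      then show ?thesis by (simp add: mult_ac)
    qed (simp add: k0)
  qed
  also have "\<dots> = c * conv W (mollifier \<tau>) x" by (simp add: conv_def)
  finally show ?thesis .
qed

text \<open>Fubini together with the evenness of the mollifier: the mollification moves from the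
  rough \<open>W\<close> to the continuous \<psi>, where it converges uniformly.\<close>

lemma integral_conv_W:
  assumes \<tau>: "\<tau> > 0" and \<psi>c: "continuous_on UNIV \<psi>"
    and supp: "\<And>x. x \<notin> cball y R \<Longrightarrow> \<psi> x = 0" and \<psi>_nonneg: "\<And>x. 0 \<le> \<psi> x"
  shows "(LINT x|lborel. \<psi> x * conv W (mollifier \<tau>) x) = (LINT z|lborel. W z * conv \<psi> (mollifier \<tau>) z)"
proof -
  let ?H = "\<lambda>x z. \<psi> x * (W z * mollifier \<tau> (z - x))"
  note [measurable] = W_measurable borel_continuous[OF \<psi>c] borel_continuous[OF mollifier_continuous[of \<tau>]]
  have sym: "mollifier \<tau> (z - x) = mollifier \<tau> (x - z)" for x z
    by (simp add: mollifier_def bump_def inner_diff_left inner_diff_right inner_commute algebra_simps)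
  have iz: "integrable lborel (\<lambda>z. W z * mollifier \<tau> (z - x))" for x
    by (intro integrable_W_mult[of _ x \<tau>] continuous_translate mollifier_continuous
        translate_zero[OF mollifier_zero[OF \<tau>]])
  have "integrable (lborel \<Otimes>\<^sub>M lborel) (case_prod ?H)"
  proof (rule lborel_pair.Fubini_integrable)
    show "case_prod ?H \<in> borel_measurable (lborel \<Otimes>\<^sub>M lborel)" by measurable
    have "integrable lborel (\<lambda>x. \<psi> x * conv W (mollifier \<tau>) x)"
      by (rule integrable_cpt_support[of _ y R])
        (auto intro!: continuous_intros \<psi>c conv_continuous[OF W_integrable mollifier_continuous mollifier_zero[OF \<tau>]] simp: supp)
    \<comment> \<open>All factors are nonnegative, so the absolute integrand required by Fubini is
      the integrand itself.\<close>
    also have "(\<lambda>x. \<psi> x * conv W (mollifier \<tau>) x) = (\<lambda>x. LINT z|lborel. norm (case_prod ?H (x, z)))"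
      by (simp add: conv_def abs_mult \<psi>_nonneg W_nonneg mollifier_nonneg[OF \<tau>])
    finally show "integrable lborel (\<lambda>x. LINT z|lborel. norm (case_prod ?H (x, z)))" .
    show "AE x in lborel. integrable lborel (\<lambda>z. case_prod ?H (x, z))"
      using iz by simp
  qed
  from lborel_pair.Fubini_integral[OF this]
  have "(LINT x|lborel. LINT z|lborel. ?H x z) = (LINT z|lborel. LINT x|lborel. ?H x z)" ..
  moreover have "(LINT z|lborel. ?H x z) = \<psi> x * conv W (mollifier \<tau>) x" for x
    by (simp add: conv_def)
  moreover have "(LINT x|lborel. ?H x z) = W z * conv \<psi> (mollifier \<tau>) z" for z
  proof -
    have "(LINT x|lborel. ?H x z) = (LINT x|lborel. W z * (\<psi> x * mollifier \<tau> (x - z)))"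
      unfolding sym[of z] by (simp add: mult_ac)
    then show ?thesis by (simp add: conv_def)
  qed
  ultimately show ?thesis by (simp only:)
qed

lemma eventually_oscillation_le:
  assumes g: "continuous_on UNIV (g :: real^3 \<Rightarrow> real)" and "e > 0"
  shows "\<forall>\<^sub>F \<tau> in at_right 0. \<tau> > 0 \<and> (\<forall>x\<in>cball y R. \<forall>z\<in>cball x \<tau>. \<bar>g z - g x\<bar> \<le> e)"
proof -
  obtain d where "d > 0" "\<And>x x'. x \<in> cball y R \<Longrightarrow> dist x x' \<le> d \<Longrightarrow> \<bar>g x - g x'\<bar> \<le> e"
    using uniformly_continuous_cball[OF assms] by metis
  then show ?thesis unfolding eventually_at_right_field
    by (intro exI[of _ d]) (auto simp: abs_minus_commute)
qed

text \<open>Since \<open>ln\<close> is concave, \<open>ln (f + \<epsilon>)\<close> is again a supersolution, but now with the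
  bounded factor \<open>f / (f + \<epsilon>) \<le> 1\<close> in front of \<open>W\<close>.\<close>

lemma integral_ln_laplacian_le:
  assumes \<epsilon>: "\<epsilon> > 0" and \<psi>: "C_k 2 \<psi>"
    and supp: "\<And>x. x \<notin> cball y R \<Longrightarrow> \<psi> x = 0" and \<psi>_nonneg: "\<And>x. 0 \<le> \<psi> x"
  shows "(LINT x|lborel. ln ((f x + \<epsilon>) / \<epsilon>) * laplacian \<psi> x) \<le> (LINT x|lborel. W x * \<psi> x)"
proof (rule tendsto_le)
  let ?m = "mollifier"
  have \<psi>c: "continuous_on UNIV \<psi>" using C_k_imp_continuous[OF \<psi>] .
  have l0: "laplacian \<psi> x = 0" if "x \<notin> cball y R" for x
    by (rule laplacian_zero[of "cball y R"]) (use supp that in auto)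
  note lapc = laplacian_continuous[OF \<psi>]
  have lapi: "integrable lborel (laplacian \<psi>)" by (rule integrable_cpt_support[OF lapc l0])
  have small: "\<forall>\<^sub>F \<tau>::real in at_right 0. 0 < \<tau> \<and> \<tau> < 1"
    unfolding eventually_at_right_field by (intro exI[of _ 1]) auto
  show "((\<lambda>\<tau>. LINT z|lborel. W z * conv \<psi> (?m \<tau>) z) \<longlongrightarrow> (LINT x|lborel. W x * \<psi> x)) (at_right 0)"
  proof (rule integral_tendsto_uniform[of "cball y (R + 1)"])
    show "set_integrable lborel (cball y (R + 1)) W" by (rule W_integrable)
    have conv0: "conv \<psi> (?m \<tau>) z = 0" if "0 < \<tau>" "\<tau> < 1" "z \<notin> cball y (R + 1)" for \<tau> z
    proof -
      have "\<psi> x * ?m \<tau> (x - z) = 0" for x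
      proof (cases "x \<in> cball y R")
        case True
        then have "x \<notin> cball z \<tau>" using that dist_triangle[of y z x] by (auto simp: dist_commute)
        then show ?thesis using translate_zero[of \<tau> "?m \<tau>" x z, OF mollifier_zero[OF that(1)]] by simp
      qed (simp add: supp)
      then show ?thesis unfolding conv_def by (simp only:) simp
    qed
    show "\<forall>\<^sub>F \<tau> in at_right 0. integrable lborel (\<lambda>z. W z * conv \<psi> (?m \<tau>) z)"
      using small
    proof (rule eventually_mono)
      fix \<tau> :: real assume "0 < \<tau> \<and> \<tau> < 1"
      then show "integrable lborel (\<lambda>z. W z * conv \<psi> (?m \<tau>) z)"
        by (intro integrable_W_mult[of _ y "R + 1"] conv0
            conv_continuous[OF set_integrable_cball_continuous[OF \<psi>c] mollifier_continuous mollifier_zero]) auto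
    qed
    show "integrable lborel (\<lambda>x. W x * \<psi> x)" by (rule integrable_W_mult[OF \<psi>c supp])
    show "\<forall>\<^sub>F \<tau> in at_right 0. \<forall>x. x \<notin> cball y (R + 1) \<longrightarrow> W x * conv \<psi> (?m \<tau>) x = W x * \<psi> x"
      using small by (rule eventually_mono) (auto simp: conv0 supp)
    show "\<forall>\<^sub>F \<tau> in at_right 0. \<forall>x\<in>cball y (R + 1). \<bar>conv \<psi> (?m \<tau>) x - \<psi> x\<bar> \<le> e" if "e > 0" for e
      by (rule eventually_mono[OF eventually_oscillation_le[OF \<psi>c that]])
        (auto intro!: conv_mollifier_bound[OF \<psi>c])
  qed
  show "((\<lambda>\<tau>. LINT x|lborel. ln ((mollified \<tau> x + \<epsilon>) / \<epsilon>) * laplacian \<psi> x)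
      \<longlongrightarrow> (LINT x|lborel. ln ((f x + \<epsilon>) / \<epsilon>) * laplacian \<psi> x)) (at_right 0)"
    unfolding mult.commute[of _ "laplacian \<psi> _"]
  proof (rule integral_tendsto_uniform[of "cball y R"])
    show "set_integrable lborel (cball y R) (laplacian \<psi>)"
      by (rule set_integrable_cball_continuous[OF lapc])
    show "\<forall>\<^sub>F \<tau> in at_right 0. integrable lborel (\<lambda>x. laplacian \<psi> x * ln ((mollified \<tau> x + \<epsilon>) / \<epsilon>))"
      using small by (rule eventually_mono)
        (use integrable_mult_continuous[OF lapi l0 continuous_ln_quotient[OF mollified_continuous mollified_nonneg \<epsilon>]] in blast)
    show "integrable lborel (\<lambda>x. laplacian \<psi> x * ln ((f x + \<epsilon>) / \<epsilon>))"
      by (rule integrable_mult_continuous[OF lapi l0 continuous_ln_quotient[OF f_continuous f_nonneg \<epsilon>]])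
    show "\<forall>\<^sub>F \<tau> in at_right 0. \<forall>x. x \<notin> cball y R \<longrightarrow>
        laplacian \<psi> x * ln ((mollified \<tau> x + \<epsilon>) / \<epsilon>) = laplacian \<psi> x * ln ((f x + \<epsilon>) / \<epsilon>)"
      by (simp add: l0)
    show "\<forall>\<^sub>F \<tau> in at_right 0. \<forall>x\<in>cball y R.
        \<bar>ln ((mollified \<tau> x + \<epsilon>) / \<epsilon>) - ln ((f x + \<epsilon>) / \<epsilon>)\<bar> \<le> e" if "e > 0" for e
    proof -
      \<comment> \<open>On nonnegative arguments
        \<open>t \<mapsto> ln ((t + \<epsilon>) / \<epsilon>)\<close> is Lipschitz with constant
        \<open>1 / \<epsilon>\<close>, so an error of \<open>e * \<epsilon>\<close> in
        \<open>f\<close> costs at most \<open>e\<close>.\<close>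
      have "e * \<epsilon> > 0" using that \<epsilon> by simp
      from eventually_oscillation_le[OF f_continuous this] show ?thesis
      proof (rule eventually_mono, intro ballI)
        fix \<tau> x assume *: "\<tau> > 0 \<and> (\<forall>x\<in>cball y R. \<forall>z\<in>cball x \<tau>. \<bar>f z - f x\<bar> \<le> e * \<epsilon>)" "x \<in> cball y R"
        then have d: "\<bar>mollified \<tau> x - f x\<bar> \<le> e * \<epsilon>"
          by (intro conv_mollifier_bound[OF f_continuous]) auto
        have "ln ((a + \<epsilon>) / \<epsilon>) - ln ((b + \<epsilon>) / \<epsilon>) \<le> e" if "0 \<le> a" "0 \<le> b" "a - b \<le> e * \<epsilon>" for a b
        proof -
          have "ln ((a + \<epsilon>) / \<epsilon>) - ln ((b + \<epsilon>) / \<epsilon>) = ln ((a + \<epsilon>) / (b + \<epsilon>))"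
            using that \<epsilon> by (simp add: ln_div)
          also have "\<dots> \<le> (a + \<epsilon>) / (b + \<epsilon>) - 1"
            by (rule ln_le_minus_one) (use that \<epsilon> in simp)
          also have "\<dots> = (a - b) / (b + \<epsilon>)"
            using that \<epsilon> by (simp add: field_simps)
          also have "\<dots> \<le> e * \<epsilon> / (b + \<epsilon>)"
            using that \<epsilon> by (intro divide_right_mono) auto
          also have "\<dots> \<le> e * \<epsilon> / \<epsilon>"
            using that \<epsilon> \<open>e > 0\<close> by (intro divide_left_mono) auto
          finally show ?thesis using \<epsilon> by simp
        qed
        from this[of "mollified \<tau> x" "f x"] this[of "f x" "mollified \<tau> x"] d
        show "\<bar>ln ((mollified \<tau> x + \<epsilon>) / \<epsilon>) - ln ((f x + \<epsilon>) / \<epsilon>)\<bar> \<le> e"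
          using mollified_nonneg[of \<tau> x] f_nonneg[of x] * by (simp add: abs_le_iff)
      qed
    qed
  qed
  \<comment> \<open>Half of \<epsilon> is spent on going from \<open>f z\<close> to
    \<open>f x\<close>, half on going from \<open>f x\<close> to the mollification. Hence
    \<open>f z \<le> mollified \<tau> x + \<epsilon>\<close> near \<open>x\<close>, and this bound
    is exactly the denominator to be cancelled.\<close>
  have "\<epsilon> / 2 > 0" using \<epsilon> by simp
  from eventually_oscillation_le[OF f_continuous this, of y R]
  show "\<forall>\<^sub>F \<tau> in at_right 0. (LINT x|lborel. ln ((mollified \<tau> x + \<epsilon>) / \<epsilon>) * laplacian \<psi> x)
      \<le> (LINT z|lborel. W z * conv \<psi> (?m \<tau>) z)"
  proof (rule eventually_mono)
    fix \<tau> assume \<tau>': "\<tau> > 0 \<and> (\<forall>x\<in>cball y R. \<forall>z\<in>cball x \<tau>. \<bar>f z - f x\<bar> \<le> \<epsilon> / 2)"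
    then have \<tau>: "\<tau> > 0" by simp
    have pos: "mollified \<tau> x + \<epsilon> > 0" for x using mollified_nonneg[OF \<tau>, of x] \<epsilon> by linarith
    have "(LINT x|lborel. ln ((mollified \<tau> x + \<epsilon>) / \<epsilon>) * laplacian \<psi> x)
      \<le> (LINT x|lborel. \<psi> x / (mollified \<tau> x + \<epsilon>) * conv f (laplacian (?m \<tau>)) x)"
      by (rule integral_ln_mollified[OF \<tau> \<epsilon> \<psi> supp \<psi>_nonneg])
    also have "\<dots> \<le> (LINT x|lborel. \<psi> x * conv W (?m \<tau>) x)"
    proof (rule integral_mono)
      have \<chi>c: "continuous_on UNIV (\<lambda>x. \<psi> x / (mollified \<tau> x + \<epsilon>))"
        by (rule continuous_on_quotient_pos[OF \<psi>c mollified_continuous[OF \<tau>] pos])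
      show "integrable lborel (\<lambda>x. \<psi> x / (mollified \<tau> x + \<epsilon>) * conv f (laplacian (?m \<tau>)) x)"
        by (rule integrable_cpt_support[of _ y R])
          (rule continuous_on_mult[OF \<chi>c laplacian_mollified_continuous[OF \<tau>]], simp add: supp)
      show "integrable lborel (\<lambda>x. \<psi> x * conv W (?m \<tau>) x)"
        by (rule integrable_cpt_support[of _ y R])
          (auto intro!: continuous_intros \<psi>c conv_continuous[OF W_integrable mollifier_continuous mollifier_zero[OF \<tau>]] simp: supp)
      show "\<psi> x / (mollified \<tau> x + \<epsilon>) * conv f (laplacian (?m \<tau>)) x \<le> \<psi> x * conv W (?m \<tau>) x" for x
      proof (cases "x \<in> cball y R")
        case True
        then have osc: "\<bar>f z - f x\<bar> \<le> \<epsilon> / 2" if "z \<in> cball x \<tau>" for z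
          using \<tau>' that by blast
        have m: "\<bar>mollified \<tau> x - f x\<bar> \<le> \<epsilon> / 2"
          by (rule conv_mollifier_bound[OF f_continuous \<tau> osc])
        have "f z \<le> mollified \<tau> x + \<epsilon>" if "z \<in> cball x \<tau>" for z
          using osc[OF that] m by linarith
        from conv_laplacian_mollifier_le[OF \<tau> this]
        have "\<psi> x / (mollified \<tau> x + \<epsilon>) * conv f (laplacian (?m \<tau>)) x
            \<le> \<psi> x / (mollified \<tau> x + \<epsilon>) * ((mollified \<tau> x + \<epsilon>) * conv W (?m \<tau>) x)"
          using pos[of x] by (intro mult_left_mono divide_nonneg_nonneg \<psi>_nonneg) auto
        then show ?thesis using pos[of x] by simp
      qed (simp add: supp)
    qed
    also have "\<dots> = (LINT z|lborel. W z * conv \<psi> (?m \<tau>) z)"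
      by (rule integral_conv_W[OF \<tau> \<psi>c supp \<psi>_nonneg])
    finally show "(LINT x|lborel. ln ((mollified \<tau> x + \<epsilon>) / \<epsilon>) * laplacian \<psi> x)
      \<le> (LINT z|lborel. W z * conv \<psi> (?m \<tau>) z)" .
  qed
qed simp

end

section \<open>The Newtonian kernel and its truncations\<close>

text \<open>On the dyadic shell between the radii \<open>r / 2 ^ (k + 1)\<close> and
  \<open>r / 2 ^ k\<close> the kernel is at most \<open>2 ^ (k + 1) / r\<close>, while the enclosing
  ball has volume proportional to \<open>(r / 2 ^ k) ^ 3\<close>. The products form a geometric
  series of ratio 1/4.\<close>

lemma integrable_inverse_norm:
  "integrable lborel (\<lambda>x::real^3. indicator (cball y r) x / norm (x - y))"
proof (cases "r > 0")
  case True
  let ?c = "unit_ball_vol (real DIM(real^3))"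
  have single: "a k \<le> (\<Sum>k. a k)" for a :: "nat \<Rightarrow> ennreal" and k
    using sum_le_suminf[OF summableI, of "{k}" a] by simp
  have series: "(\<integral>\<^sup>+x. (\<Sum>k. a k * indicator (cball y (b k)) x) \<partial>lborel)
      = (\<Sum>k. a k * emeasure lborel (cball y (b k)))" for a :: "nat \<Rightarrow> ennreal" and b
  proof -
    have [measurable]: "cball y t \<in> sets borel" for t by simp
    have "(\<integral>\<^sup>+x. (\<Sum>k. a k * indicator (cball y (b k)) x) \<partial>lborel)
        = (\<Sum>k. \<integral>\<^sup>+x. a k * indicator (cball y (b k)) x \<partial>lborel)"
      by (rule nn_integral_suminf) measurable
    then show ?thesis by (simp add: nn_integral_cmult_indicator)
  qed
  have pt: "ennreal (indicator (cball y r) x / norm (x - y))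
      \<le> (\<Sum>k. ennreal (2 ^ (k + 1) / r) * indicator (cball y (r / 2 ^ k)) x)" for x :: "real^3"
  proof (cases "x \<in> cball y r \<and> x \<noteq> y")
    case x: True
    then have d: "norm (x - y) > 0" "norm (x - y) \<le> r" by (auto simp: dist_norm norm_minus_commute)
    obtain n0 where "(1 / 2) ^ n0 < norm (x - y) / r"
      using real_arch_pow_inv[of "norm (x - y) / r" "1 / 2"] d True by auto
    then have "r / 2 ^ n0 < norm (x - y)" using True by (simp add: field_simps power_divide)
    \<comment> \<open>The first dyadic radius below \<open>norm (x - y)\<close> identifies the
      shell. Its index is not 0 because \<open>norm (x - y) \<le> r\<close>, so it has a predecessor
      \<open>k\<close>.\<close>
    then obtain n where n: "r / 2 ^ n < norm (x - y)" "\<And>m. m < n \<Longrightarrow> \<not> r / 2 ^ m < norm (x - y)"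
      using exists_least_iff[of "\<lambda>n. r / 2 ^ n < norm (x - y)"] by blast
    with d have "n \<noteq> 0" by (metis div_by_1 leD power_0)
    then obtain k where k: "n = Suc k" using not0_implies_Suc by blast
    have k1: "r / 2 ^ (k + 1) < norm (x - y)" "norm (x - y) \<le> r / 2 ^ k"
      using n(1) n(2)[of k] k by auto
    have "indicator (cball y r) x / norm (x - y) \<le> 2 ^ (k + 1) / r"
      using k1(1) d True x by (simp add: field_simps)
    then have "ennreal (indicator (cball y r) x / norm (x - y))
        \<le> ennreal (2 ^ (k + 1) / r) * indicator (cball y (r / 2 ^ k)) x"
      using k1(2) True by (auto simp: dist_norm norm_minus_commute intro!: ennreal_leI)
    also have "\<dots> \<le> (\<Sum>k. ennreal (2 ^ (k + 1) / r) * indicator (cball y (r / 2 ^ k)) x)"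
      by (rule single)
    finally show ?thesis .
  qed auto
  have "(\<integral>\<^sup>+x. ennreal (indicator (cball y r) x / norm (x - y)) \<partial>lborel)
      \<le> (\<integral>\<^sup>+x. (\<Sum>k. ennreal (2 ^ (k + 1) / r) * indicator (cball y (r / 2 ^ k)) x) \<partial>lborel)"
    by (rule nn_integral_mono) (rule pt)
  also have "\<dots> = (\<Sum>k. ennreal (2 ^ (k + 1) / r) * emeasure lborel (cball y (r / 2 ^ k)))"
    by (rule series)
  also have "\<dots> = (\<Sum>k. ennreal (2 * ?c * r\<^sup>2 * (1 / 4) ^ k))"
  proof -
    have "(2 ^ (k + 1) / r) * (?c * (r / 2 ^ k) ^ 3) = 2 * ?c * r\<^sup>2 * (1 / 4) ^ k" for k
    proof -
      have "((2::real) ^ k) ^ 2 = 4 ^ k" by (simp add: power2_eq_square flip: power_mult_distrib)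
      then show ?thesis using True
        by (simp add: field_simps power_divide power2_eq_square power3_eq_cube)
    qed
    moreover have "ennreal (2 ^ (k + 1) / r) * emeasure lborel (cball y (r / 2 ^ k))
        = ennreal ((2 ^ (k + 1) / r) * (?c * (r / 2 ^ k) ^ 3))" for k
    proof -
      have "emeasure lborel (cball y (r / 2 ^ k)) = ennreal (?c * (r / 2 ^ k) ^ 3)"
        using True by (subst emeasure_cball) auto
      then show ?thesis using True by (simp only:) (intro ennreal_mult[symmetric], auto)
    qed
    ultimately show ?thesis by (simp only:)
  qed
  also have "\<dots> = ennreal (\<Sum>k. 2 * ?c * r\<^sup>2 * (1 / 4) ^ k)"
  proof (rule suminf_ennreal2)
    show "summable (\<lambda>k. 2 * ?c * r\<^sup>2 * (1 / 4) ^ k)"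
      by (rule summable_mult) (rule summable_geometric, simp)
  qed simp
  also have "\<dots> < \<infinity>" by simp
  finally have fin: "(\<integral>\<^sup>+x. ennreal (indicator (cball y r) x / norm (x - y)) \<partial>lborel) < \<infinity>" .
  show ?thesis
  proof (rule integrableI_nonneg[OF _ _ fin])
    have [measurable]: "cball y r \<in> sets borel" by simp
    show "(\<lambda>x. indicator (cball y r) x / norm (x - y)) \<in> borel_measurable lborel"
      by measurable
  qed simp
next
  case False
  \<comment> \<open>For \<open>r \<le> 0\<close> at most the point \<open>y\<close> remains, where
    division by zero gives 0.\<close>
  have "indicator (cball y r) x / norm (x - y) = 0" for x
  proof (cases "x = y")
    case False
    then have "0 < dist y x" by simp
    with \<open>\<not> r > 0\<close> have "x \<notin> cball y r" unfolding mem_cball by linarith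
    then show ?thesis by simp
  qed simp
  then show ?thesis by (simp only: integrable_zero)
qed

text \<open>A smooth convex substitute for the positive part. The factor \<open>u\<close> makes it
  grow linearly, so that it preserves the \<open>1 / |x - y|\<close> behaviour; its second
  derivative \<open>exp (- 1 / u) / u ^ 3\<close> is positive for \<open>u > 0\<close>, the source
  of the strict subharmonicity.\<close>

definition ramp :: "real \<Rightarrow> real" where
  "ramp u = u * flat 1 u"

lemma ramp_derivative: "(ramp has_real_derivative flat [:1, 1:] u) (at u)"
proof -
  have "(ramp has_real_derivative u * flat (flat_step 1) u + flat 1 u) (at u)"
    unfolding ramp_def[abs_def] by (auto intro!: derivative_eq_intros flat_has_derivative)
  moreover have "u * flat (flat_step 1) u + flat 1 u = flat [:1, 1:] u"
    by (simp add: flat_def flat_step_def one_pCons algebra_simps add_divide_distrib)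
  ultimately show ?thesis by simp
qed

lemma ramp_derivative2: "(flat [:1, 1:] has_real_derivative flat [:0, 0, 0, 1:] u) (at u)"
proof -
  have "flat_step [:1, 1:] = [:0, 0, 0, 1:]"
    by (simp add: flat_step_def pderiv_pCons)
  with flat_has_derivative[of "[:1, 1:]" u] show ?thesis by simp
qed

lemma ramp_nonneg: "0 \<le> ramp u"
  by (simp add: ramp_def flat_def)

lemma ramp_le: "0 \<le> u \<Longrightarrow> ramp u \<le> u"
  by (simp add: ramp_def flat_def mult_left_le)

lemma ramp_deriv_bounds: "0 \<le> flat [:1, 1:] u" "flat [:1, 1:] u \<le> 1"
proof -
  show "0 \<le> flat [:1, 1:] u" by (simp add: flat_def)
  show "flat [:1, 1:] u \<le> 1"
    using exp_ge_add_one_self[of "1 / u"] by (auto simp: flat_def exp_minus divide_inverse[symmetric])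
qed

text \<open>With \<open>v = 1 / u\<close> the left side is
  \<open>(1 + v / R) ^ 3 * exp (- v) * (u + 1 / R)\<close>, and
  \<open>1 + v / R \<le> max 1 (3 / R) * exp (v / 3)\<close>; cubing cancels the exponential. In
  use, \<open>u + 1 / R\<close> is the regularised \<open>1 / |x - y|\<close>: three of its four
  powers are absorbed and one integrable power remains.\<close>

lemma ramp_deriv2_bound:
  assumes "R > 0" "u > 0"
  shows "flat [:0, 0, 0, 1:] u * (u + 1 / R) ^ 4 \<le> (max 1 (3 / R)) ^ 3 * (u + 1 / R)"
proof -
  define v where "v = 1 / u"
  have v: "v > 0" "u = 1 / v" using assms by (auto simp: v_def)
  have "1 + v / R \<le> max 1 (3 / R) * (1 + v / 3)"
  proof -
    have "v / R = (3 / R) * (v / 3)" by simp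
    also have "\<dots> \<le> max 1 (3 / R) * (v / 3)" using v by (intro mult_right_mono) auto
    finally have "v / R \<le> max 1 (3 / R) * (v / 3)" .
    then have "1 + v / R \<le> max 1 (3 / R) * 1 + max 1 (3 / R) * (v / 3)"
      by (intro add_mono) auto
    then show ?thesis by (simp only: distrib_left)
  qed
  also have "\<dots> \<le> max 1 (3 / R) * exp (v / 3)"
    by (intro mult_left_mono exp_ge_add_one_self) auto
  finally have "(1 + v / R) ^ 3 \<le> (max 1 (3 / R) * exp (v / 3)) ^ 3"
    using v assms by (intro power_mono) auto
  also have "\<dots> = max 1 (3 / R) ^ 3 * exp v"
    using exp_of_nat_mult[of 3 "v / 3"] by (simp add: power_mult_distrib)
  finally have "(1 + v / R) ^ 3 * exp (- v) \<le> max 1 (3 / R) ^ 3"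
    by (simp add: exp_minus field_simps)
  then have "(1 + v / R) ^ 3 * exp (- v) * (u + 1 / R) \<le> max 1 (3 / R) ^ 3 * (u + 1 / R)"
    using assms by (intro mult_right_mono) auto
  moreover have "flat [:0, 0, 0, 1:] u * (u + 1 / R) ^ 4 = (1 + v / R) ^ 3 * exp (- v) * (u + 1 / R)"
  proof -
    have "v * (u + 1 / R) = 1 + v / R" using v by (simp add: field_simps)
    moreover have "flat [:0, 0, 0, 1:] u * (u + 1 / R) ^ 4 = (v * (u + 1 / R)) ^ 3 * exp (- v) * (u + 1 / R)"
    proof -
      have "flat [:0, 0, 0, 1:] u = v ^ 3 * exp (- v)"
        using assms by (simp add: flat_def v_def power3_eq_cube)
      then show ?thesis by (simp add: power_mult_distrib power3_eq_cube power4_eq_xxxx mult_ac)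
    qed
    ultimately show ?thesis by simp
  qed
  ultimately show ?thesis by simp
qed

section \<open>The regularised inverse distance and the barriers\<close>

definition inv_dist :: "real \<Rightarrow> real \<Rightarrow> real" where
  "inv_dist s t = inverse (sqrt (t + s\<^sup>2))"

lemma inv_dist_derivative:
  assumes "s > 0" "t \<ge> 0"
  shows "(inv_dist s has_real_derivative - (inv_dist s t ^ 3) / 2) (at t)"
proof -
  have "t + s\<^sup>2 > 0" using assms by (simp add: add_nonneg_pos)
  then have "((\<lambda>t. sqrt (t + s\<^sup>2)) has_real_derivative inverse (sqrt (t + s\<^sup>2)) / 2 * 1) (at t)"
    by (intro DERIV_chain2[OF DERIV_real_sqrt]) (auto intro!: derivative_eq_intros)
  then have "(inv_dist s has_real_derivative
      - (inverse (sqrt (t + s\<^sup>2)) * (inverse (sqrt (t + s\<^sup>2)) / 2 * 1) * inverse (sqrt (t + s\<^sup>2)))) (at t)"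
    unfolding inv_dist_def[abs_def] by (rule DERIV_inverse') (use \<open>t + s\<^sup>2 > 0\<close> in simp)
  then show ?thesis by (simp add: inv_dist_def power3_eq_cube)
qed

lemma inv_dist_sq:
  assumes "s > 0" "t \<ge> 0" shows "inv_dist s t ^ 2 * (t + s\<^sup>2) = 1" "inv_dist s t > 0"
proof -
  have "t + s\<^sup>2 > 0" using assms by (simp add: add_nonneg_pos)
  then show "inv_dist s t ^ 2 * (t + s\<^sup>2) = 1" "inv_dist s t > 0"
    by (auto simp: inv_dist_def power_inverse)
qed

text \<open>
  With \<open>q = 1 / inv_dist s |x - y|\<^sup>2\<close>, i.e. \<open>q\<^sup>2 = |x - y|\<^sup>2 + s\<^sup>2\<close>, the Laplacian of \<open>1 / q\<close> is
  \<open>- 3 s\<^sup>2 / q\<^sup>5\<close>, an approximate identity up to a factor. Composing \<open>1 / q - 1 / R\<close> with a convex ramp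
  cuts it off at \<open>q = R\<close> and only adds the nonnegative term \<open>barrier_pos\<close>.
\<close>

definition barrier :: "real \<Rightarrow> real \<Rightarrow> real^3 \<Rightarrow> real^3 \<Rightarrow> real" where
  "barrier R s y x = ramp (inv_dist s ((x - y) \<bullet> (x - y)) - 1 / R)"

definition barrier_pos :: "real \<Rightarrow> real \<Rightarrow> real^3 \<Rightarrow> real^3 \<Rightarrow> real" where
  "barrier_pos R s y x = (let t = (x - y) \<bullet> (x - y) in
     flat [:0, 0, 0, 1:] (inv_dist s t - 1 / R) * t * inv_dist s t ^ 6)"

definition barrier_neg :: "real \<Rightarrow> real \<Rightarrow> real^3 \<Rightarrow> real^3 \<Rightarrow> real" where
  "barrier_neg R s y x = (let t = (x - y) \<bullet> (x - y) in
     3 * s\<^sup>2 * flat [:1, 1:] (inv_dist s t - 1 / R) * inv_dist s t ^ 5)"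

text \<open>The chain rule \<open>\<Delta> ramp(w) = ramp''(w) |\<nabla>w|^2 + ramp'(w)
  \<Delta>w\<close> for \<open>w = 1 / q - 1 / R\<close>, where
  \<open>|\<nabla>w|^2 = t / q^6\<close> and \<open>\<Delta>w = - 3 s^2 / q^5\<close>. The two terms
  are \<open>barrier_pos\<close> and minus \<open>barrier_neg\<close>.\<close>

lemma barrier_C_2_laplacian:
  assumes s: "s > 0"
  shows "C_k 2 (barrier R s y)"
    and "laplacian (barrier R s y) x = barrier_pos R s y x - barrier_neg R s y x"
proof -
  let ?U = "\<lambda>t. inv_dist s t - 1 / R"
  define G0 where "G0 = (\<lambda>t. ramp (?U t))"
  define G1 where "G1 = (\<lambda>t. flat [:1, 1:] (?U t) * (- (inv_dist s t ^ 3) / 2))"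
  define G2 where "G2 = (\<lambda>t. flat [:0, 0, 0, 1:] (?U t) * (- (inv_dist s t ^ 3) / 2)\<^sup>2
      + flat [:1, 1:] (?U t) * (3 / 4 * inv_dist s t ^ 5))"
  have U: "(?U has_real_derivative - (inv_dist s t ^ 3) / 2) (at t)" if "t \<ge> 0" for t
    using DERIV_diff[OF inv_dist_derivative[OF s that] DERIV_const] by simp
  have D1: "(G0 has_real_derivative G1 t) (at t)" if "t \<ge> 0" for t
    unfolding G0_def G1_def by (rule DERIV_chain2[OF ramp_derivative U[OF that]])
  have D2: "(G1 has_real_derivative G2 t) (at t)" if "t \<ge> 0" for t
  proof -
    have "((\<lambda>t. - (inv_dist s t ^ 3) / 2) has_real_derivative 3 / 4 * inv_dist s t ^ 5) (at t)"
    proof -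
      have "- 1 / 2 * (real 3 * (- (p ^ 3) / 2 * p ^ (3 - Suc 0))) = 3 / 4 * p ^ 5" for p :: real
        by (simp add: eval_nat_numeral)
      with DERIV_cmult[OF DERIV_power[OF inv_dist_derivative[OF s that], of 3], of "- 1 / 2"]
      show ?thesis by (simp only:) simp
    qed
    from DERIV_mult[OF DERIV_chain2[OF ramp_derivative2 U[OF that]] this]
    show ?thesis unfolding G1_def G2_def by (simp add: power2_eq_square algebra_simps)
  qed
  have barrier: "barrier R s y = (\<lambda>x. G0 ((x - y) \<bullet> (x - y)))"
    by (simp add: barrier_def G0_def fun_eq_iff)
  have ic: "continuous_on {0..} (inv_dist s)"
    by (intro continuous_at_imp_continuous_on ballI DERIV_isCont[OF inv_dist_derivative[OF s]]) simp
  have "C_k 2 (\<lambda>x. ([G0, G1, G2] ! 0) ((x - y) \<bullet> (x - y)))"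
  proof (rule C_k_radial[where G = "\<lambda>m. [G0, G1, G2] ! m"])
    show "(([G0, G1, G2] ! m) has_real_derivative ([G0, G1, G2] ! Suc m) t) (at t)"
      if "m < 2" "0 \<le> t" for m t
    proof -
      have "m = 0 \<or> m = 1" using that by linarith
      then show ?thesis using D1[OF that(2)] D2[OF that(2)] by auto
    qed
    have "continuous_on {0..} G2" unfolding G2_def
      by (intro continuous_intros ic continuous_on_compose2[OF flat_continuous]) auto
    then show "continuous_on {0..} ([G0, G1, G2] ! 2)" by simp
  qed
  then show "C_k 2 (barrier R s y)" by (simp add: barrier)
  let ?t = "(x - y) \<bullet> (x - y)"
  \<comment> \<open>\<open>a\<close> and \<open>b\<close> stand for the second and first derivative
    of \<open>ramp\<close>. The relation for \<open>p\<close> turns \<open>p ^ 3\<close> into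
    \<open>p ^ 5 * (t + s\<^sup>2)\<close>; the parts with \<open>t * p ^ 5\<close> cancel and only
    the one with \<open>s\<^sup>2\<close> survives.\<close>
  have *: "4 * t * (a * (- (p ^ 3) / 2)\<^sup>2 + b * (3 / 4 * p ^ 5)) + 6 * (b * (- (p ^ 3) / 2))
      = a * t * p ^ 6 - 3 * s\<^sup>2 * b * p ^ 5" if "p\<^sup>2 * (t + s\<^sup>2) = 1" for a b p t :: real
  proof -
    have "4 * t * (a * (- (p ^ 3) / 2)\<^sup>2 + b * (3 / 4 * p ^ 5)) + 6 * (b * (- (p ^ 3) / 2))
        - (a * t * p ^ 6 - 3 * s\<^sup>2 * b * p ^ 5) = 3 * b * p ^ 3 * (p\<^sup>2 * (t + s\<^sup>2) - 1)"
      by (simp add: algebra_simps eval_nat_numeral)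
    with that show ?thesis by simp
  qed
  have "laplacian (barrier R s y) x = 4 * ?t * G2 ?t + 6 * G1 ?t"
    unfolding barrier by (rule laplacian_radial[OF D1 D2])
  also have "\<dots> = barrier_pos R s y x - barrier_neg R s y x"
    unfolding G2_def G1_def barrier_pos_def barrier_neg_def Let_def
    by (rule *) (simp add: inv_dist_sq[OF s])
  finally show "laplacian (barrier R s y) x = barrier_pos R s y x - barrier_neg R s y x" .
qed

lemma inv_dist_le_inverse:
  assumes "s > 0" "0 < r" "r\<^sup>2 \<le> t" shows "inv_dist s t \<le> 1 / r"
proof -
  have "r = sqrt (r\<^sup>2)" using assms by simp
  also have "\<dots> \<le> sqrt (t + s\<^sup>2)" using assms by (intro real_sqrt_le_mono) (auto intro: add_increasing2)
  finally show ?thesis using assms(2)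
    by (simp add: inv_dist_def le_imp_inverse_le flip: inverse_eq_divide)
qed

lemma inv_dist_ge_inverse:
  assumes "s > 0" "0 < r" "0 \<le> t" "t + s\<^sup>2 \<le> r\<^sup>2" shows "1 / r \<le> inv_dist s t"
proof -
  have p: "t + s\<^sup>2 > 0" using assms by (simp add: add_nonneg_pos)
  have "sqrt (t + s\<^sup>2) \<le> sqrt (r\<^sup>2)" using assms by (intro real_sqrt_le_mono) auto
  also have "\<dots> = r" using assms by simp
  finally show ?thesis using p
    by (simp add: inv_dist_def le_imp_inverse_le flip: inverse_eq_divide)
qed

lemma barrier_zero:
  assumes "s > 0" "R > 0" "x \<notin> ball y R"
  shows "barrier R s y x = 0" "barrier_pos R s y x = 0" "barrier_neg R s y x = 0"
proof -
  have "R\<^sup>2 \<le> (norm (x - y))\<^sup>2"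
    using assms by (intro power_mono) (auto simp: dist_norm norm_minus_commute)
  then have "inv_dist s ((x - y) \<bullet> (x - y)) \<le> 1 / R"
    using inv_dist_le_inverse[OF assms(1,2)] by (simp add: power2_norm_eq_inner)
  then show "barrier R s y x = 0" "barrier_pos R s y x = 0" "barrier_neg R s y x = 0"
    by (auto simp: barrier_def barrier_pos_def barrier_neg_def Let_def ramp_def flat_def)
qed

lemma barrier_nonneg:
  assumes "s > 0"
  shows "0 \<le> barrier R s y x" "0 \<le> barrier_pos R s y x" "0 \<le> barrier_neg R s y x"
  using ramp_deriv_bounds(1) inv_dist_sq(2)[OF assms, of "(x - y) \<bullet> (x - y)"]
  by (auto simp: barrier_def barrier_pos_def barrier_neg_def Let_def ramp_nonneg
      intro!: mult_nonneg_nonneg flat_nonneg)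

lemma inv_dist_le_norm: "s > 0 \<Longrightarrow> x \<noteq> y \<Longrightarrow> inv_dist s ((x - y) \<bullet> (x - y)) \<le> 1 / norm (x - y)"
  by (rule inv_dist_le_inverse) (auto simp: power2_norm_eq_inner)

lemma barrier_le:
  assumes "s > 0" "R > 0" "x \<noteq> y"
  shows "barrier R s y x \<le> indicator (ball y R) x / norm (x - y)"
proof (cases "x \<in> ball y R \<and> inv_dist s ((x - y) \<bullet> (x - y)) > 1 / R")
  case True
  then have "barrier R s y x \<le> inv_dist s ((x - y) \<bullet> (x - y)) - 1 / R"
    unfolding barrier_def by (intro ramp_le) simp
  also have "\<dots> \<le> 1 / norm (x - y)"
    using inv_dist_le_norm[OF assms(1,3)] assms(2) by (smt (verit) divide_pos_pos)
  finally show ?thesis using True by simp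
next
  case False
  then have "barrier R s y x = 0"
    using barrier_zero[OF assms(1,2), of x y] by (auto simp: barrier_def ramp_def flat_def)
  then show ?thesis by simp
qed

text \<open>The bound does not depend on \<open>s\<close>. Two of the six powers of
  \<open>inv_dist\<close> are absorbed by \<open>t\<close>, and \<open>ramp_deriv2_bound\<close>
  takes care of the other four.\<close>

lemma barrier_pos_le:
  assumes "s > 0" "R > 0" "x \<noteq> y"
  shows "barrier_pos R s y x \<le> max 1 (3 / R) ^ 3 * (indicator (cball y R) x / norm (x - y))"
proof (cases "x \<in> ball y R \<and> inv_dist s ((x - y) \<bullet> (x - y)) > 1 / R")
  case True
  let ?t = "(x - y) \<bullet> (x - y)"
  let ?p = "inv_dist s ?t"
  have "?p\<^sup>2 * ?t \<le> ?p\<^sup>2 * (?t + s\<^sup>2)" by (intro mult_left_mono) auto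
  then have 1: "?p\<^sup>2 * ?t \<le> 1" using inv_dist_sq(1)[OF assms(1), of ?t] by simp
  have "barrier_pos R s y x = (flat [:0, 0, 0, 1:] (?p - 1 / R) * ?p ^ 4) * (?p\<^sup>2 * ?t)"
    by (simp add: barrier_pos_def Let_def eval_nat_numeral mult_ac)
  also have "\<dots> \<le> (flat [:0, 0, 0, 1:] (?p - 1 / R) * ?p ^ 4) * 1"
    by (intro mult_left_mono 1 mult_nonneg_nonneg flat_nonneg) auto
  also have "\<dots> \<le> max 1 (3 / R) ^ 3 * ?p"
    using ramp_deriv2_bound[OF assms(2), of "?p - 1 / R"] True by simp
  also have "\<dots> \<le> max 1 (3 / R) ^ 3 * (1 / norm (x - y))"
    by (intro mult_left_mono inv_dist_le_norm assms) auto
  finally show ?thesis using True by simp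
next
  case False
  then have "barrier_pos R s y x = 0"
    using barrier_zero[OF assms(1,2), of x y] by (auto simp: barrier_pos_def Let_def flat_def)
  then show ?thesis by simp
qed

text \<open>Again uniform in \<open>s\<close>: the argument of the second derivative of
  \<open>ramp\<close> lies between \<open>1 / R2 - 1 / R\<close> and \<open>1 / r\<close>. The lower
  end controls the exponential and the upper end the cubic factor; the rest uses
  \<open>t \<ge> r\<^sup>2\<close> and \<open>inv_dist \<ge> 1 / R\<close>.\<close>

lemma barrier_pos_ge:
  assumes "s > 0" "0 < r" "R2 < R" "0 < R2" "r \<le> norm (x - y)" "(norm (x - y))\<^sup>2 + s\<^sup>2 \<le> R2\<^sup>2"
  shows "exp (- 1 / (1 / R2 - 1 / R)) * r ^ 3 * r\<^sup>2 / R ^ 6 \<le> barrier_pos R s y x"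
proof -
  let ?t = "(x - y) \<bullet> (x - y)"
  let ?p = "inv_dist s ?t"
  let ?u = "?p - 1 / R"
  let ?w = "1 / R2 - 1 / R"
  have t: "?t = (norm (x - y))\<^sup>2" by (simp add: power2_norm_eq_inner)
  have rt: "r\<^sup>2 \<le> ?t" unfolding t using assms by (intro power_mono) auto
  have p1: "?p \<le> 1 / r" by (rule inv_dist_le_inverse[OF assms(1,2) rt])
  have p2: "1 / R2 \<le> ?p" by (rule inv_dist_ge_inverse) (use assms t in auto)
  have u0: "?w > 0" using assms by (simp add: frac_less2)
  have "1 / R \<le> ?p" using p2 u0 by linarith
  have u: "?w \<le> ?u" "?u > 0" "?u \<le> 1 / r" using p1 p2 u0 divide_pos_pos[of 1 R] assms by linarith+
  have "exp (- 1 / ?w) \<le> exp (- 1 / ?u)"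
    using u u0 by (simp add: frac_le)
  moreover have "r ^ 3 \<le> (1 / ?u) ^ 3"
    using u assms by (intro power_mono) (auto simp: field_simps)
  ultimately have "r ^ 3 * exp (- 1 / ?w) \<le> (1 / ?u) ^ 3 * exp (- 1 / ?u)"
    using u assms by (intro mult_mono) auto
  also have "\<dots> = flat [:0, 0, 0, 1:] ?u"
    using u by (simp add: flat_def power3_eq_cube)
  finally have "(r ^ 3 * exp (- 1 / ?w)) * r\<^sup>2 * (1 / R) ^ 6 \<le> flat [:0, 0, 0, 1:] ?u * ?t * ?p ^ 6"
    using \<open>1 / R \<le> ?p\<close> rt assms by (intro mult_mono power_mono mult_nonneg_nonneg flat_nonneg) auto
  then show ?thesis by (simp add: barrier_pos_def Let_def power_one_over mult_ac)
qed

section \<open>Propagation of zeros\<close>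

lemma integrable_barrier_parts:
  assumes s: "s > 0" and R: "R > 0" and l: "continuous_on UNIV l"
  shows "integrable lborel (\<lambda>x. l x * barrier_pos R s y x)"
    and "integrable lborel (\<lambda>x. l x * barrier_neg R s y x)"
proof -
  have "continuous_on {0..} (inv_dist s)"
    by (intro continuous_at_imp_continuous_on ballI DERIV_isCont[OF inv_dist_derivative[OF s]]) simp
  then have ic: "continuous_on UNIV (\<lambda>x. inv_dist s ((x - y) \<bullet> (x - y)))"
    by (rule continuous_on_compose2) (auto intro!: continuous_intros)
  have "continuous_on UNIV (barrier_pos R s y)" "continuous_on UNIV (barrier_neg R s y)"
    unfolding barrier_pos_def[abs_def] barrier_neg_def[abs_def] Let_def
    by (intro continuous_intros ic continuous_on_compose2[OF flat_continuous] subset_UNIV)+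
  then show "integrable lborel (\<lambda>x. l x * barrier_pos R s y x)"
    "integrable lborel (\<lambda>x. l x * barrier_neg R s y x)"
    by (auto intro!: integrable_cpt_support[of _ y R] continuous_on_mult[OF l] simp: barrier_zero[OF s R])
qed

text \<open>A compactly supported Laplacian has integral zero, so both parts have the same mass, and
  that of the positive part is bounded uniformly in \<open>s\<close>. The mass of the approximate
  identity need not be computed.\<close>

lemma integral_barrier_neg_le:
  assumes s: "s > 0" and R: "R > 0"
  shows "(LINT x|lborel. barrier_neg R s y x)
    \<le> max 1 (3 / R) ^ 3 * (LINT x|lborel. indicator (cball y R) x / norm (x - y))"
proof -
  note i = integrable_barrier_parts[OF s R continuous_on_const[of _ 1], simplified]
  have "(LINT x|lborel. laplacian (barrier R s y) x) = 0"
    by (rule integral_laplacian_eq_0[OF barrier_C_2_laplacian(1)[OF s], of y R])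
      (auto simp: barrier_zero[OF s R])
  then have "(LINT x|lborel. barrier_neg R s y x) = (LINT x|lborel. barrier_pos R s y x)"
    by (simp add: barrier_C_2_laplacian(2)[OF s] i)
  also have "\<dots> \<le> (LINT x|lborel. max 1 (3 / R) ^ 3 * (indicator (cball y R) x / norm (x - y)))"
  proof (rule integral_mono_AE[OF i(1)])
    show "integrable lborel (\<lambda>x. max 1 (3 / R) ^ 3 * (indicator (cball y R) x / norm (x - y)))"
      by (rule integrable_mult_right) (rule integrable_inverse_norm)
    show "AE x in lborel. barrier_pos R s y x \<le> max 1 (3 / R) ^ 3 * (indicator (cball y R) x / norm (x - y))"
      by (rule eventually_mono[OF AE_lborel_singleton[of y]]) (rule barrier_pos_le[OF s R])
  qed
  finally show ?thesis by (simp only: integral_mult_right_zero)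
qed

text \<open>Off any ball around \<open>y\<close> the negative part is of order
  \<open>s\<^sup>2\<close>; with its bounded total mass this is the concentration at
  \<open>y\<close>.\<close>

lemma barrier_neg_le:
  assumes "s > 0" "\<rho> > 0" "\<rho> \<le> norm (x - y)"
  shows "barrier_neg R s y x \<le> 3 * s\<^sup>2 / \<rho> ^ 5"
proof -
  let ?t = "(x - y) \<bullet> (x - y)"
  have "\<rho>\<^sup>2 \<le> ?t" using assms power_mono[of \<rho> "norm (x - y)" 2] by (simp add: power2_norm_eq_inner)
  then have "inv_dist s ?t \<le> 1 / \<rho>" by (rule inv_dist_le_inverse[OF assms(1,2)])
  then have "3 * s\<^sup>2 * flat [:1, 1:] (inv_dist s ?t - 1 / R) * inv_dist s ?t ^ 5 \<le> 3 * s\<^sup>2 * 1 * (1 / \<rho>) ^ 5"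
    using inv_dist_sq(2)[OF assms(1), of ?t] ramp_deriv_bounds
    by (intro mult_mono power_mono mult_left_mono mult_nonneg_nonneg) auto
  then show ?thesis by (simp add: barrier_neg_def Let_def power_one_over)
qed

context supersolution
begin

text \<open>Testing \<open>ln ((f + \<epsilon>) / \<epsilon>)\<close>, which vanishes at \<open>y\<close>, against the barriers: as \<open>s \<rightarrow> 0\<close> the
  negative part of their Laplacian concentrates at \<open>y\<close>, and what remains is bounded by the
  Newtonian potential of \<open>W\<close> at \<open>y\<close>, uniformly in \<open>\<epsilon>\<close>. Hence \<open>\<epsilon> \<rightarrow> 0\<close> leaves no room for \<open>f > 0\<close>.\<close>

lemma zero_propagates:
  assumes R: "R > 0" and fy: "f y = 0"
    and fin: "(\<integral>\<^sup>+x\<in>ball y R. ennreal (W x / norm (x - y)) \<partial>lborel) < \<infinity>"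
    and x1: "x1 \<in> ball y R"
  shows "f x1 = 0"
proof (rule ccontr)
  assume "f x1 \<noteq> 0"
  define \<delta> where "\<delta> = f x1 / 2"
  have \<delta>: "\<delta> > 0" using \<open>f x1 \<noteq> 0\<close> f_nonneg[of x1] by (simp add: \<delta>_def)
  define D where "D = norm (x1 - y)"
  have D: "D > 0" "D < R"
    using \<open>f x1 \<noteq> 0\<close> fy x1 by (auto simp: D_def dist_norm norm_minus_commute)
  obtain d where d: "d > 0" "\<And>x. dist x1 x \<le> d \<Longrightarrow> \<bar>f x1 - f x\<bar> \<le> \<delta>"
    using uniformly_continuous_cball[OF f_continuous \<delta>, of x1 0] by (metis centre_in_cball order_refl)
  \<comment> \<open>The three bounds keep \<open>f \<ge> \<delta>\<close> on the ball around
    \<open>x1\<close>, keep that ball away from \<open>y\<close>, and keep it within distance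
    \<open>R1\<close> of \<open>y\<close>.\<close>
  define r where "r = min d (min (D / 2) ((R - D) / 4))"
  have r: "r > 0" "r \<le> d" "r \<le> D / 2" "r \<le> (R - D) / 4"
    using d(1) D by (auto simp: r_def min_def)
  \<comment> \<open>The gap from \<open>R1\<close> to \<open>R2\<close> makes room for
    \<open>s\<^sup>2\<close>; the gap from \<open>R2\<close> to \<open>R\<close> keeps the ramp
    argument away from 0, so that the lower bound \<open>a\<close> is positive.\<close>
  define R1 where "R1 = D + (R - D) / 4"
  define R2 where "R2 = D + (R - D) / 2"
  have R12: "0 < R1" "R1 < R2" "R2 < R" using D by (auto simp: R1_def R2_def field_simps)
  have near: "\<delta> \<le> f x" "D / 2 \<le> norm (x - y)" "norm (x - y) \<le> R1" if "x \<in> ball x1 r" for x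
  proof -
    have dx: "dist x1 x < r" using that by simp
    have "\<bar>f x1 - f x\<bar> \<le> \<delta>" by (rule d(2)) (use dx r(2) in linarith)
    moreover have "f x1 = 2 * \<delta>" by (simp add: \<delta>_def)
    ultimately show "\<delta> \<le> f x" by linarith
    have "D \<le> dist x1 x + norm (x - y)" "norm (x - y) \<le> dist x1 x + D"
      using norm_triangle_ineq[of "x1 - x" "x - y"] norm_triangle_ineq[of "x - x1" "x1 - y"]
      by (simp_all add: D_def dist_norm norm_minus_commute)
    with dx r show "D / 2 \<le> norm (x - y)" "norm (x - y) \<le> R1"
      unfolding R1_def by - linarith+
  qed
  define a where "a = exp (- 1 / (1 / R2 - 1 / R)) * (D / 2) ^ 3 * (D / 2)\<^sup>2 / R ^ 6"
  define c where "c = a * measure lborel (ball x1 r)"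
  have "a > 0" using D R by (simp add: a_def)
  then have c: "c > 0" using r by (simp add: c_def)
  define N where "N = max 1 (3 / R) ^ 3 * (LINT x|lborel. indicator (cball y R) x / norm (x - y))"
  define Q where "Q = (LINT x|lborel. W x * (indicator (ball y R) x / norm (x - y)))"
  have Qi: "integrable lborel (\<lambda>x. W x * (indicator (ball y R) x / norm (x - y)))"
  proof (rule integrableI_nonneg)
    note [measurable] = W_measurable
    have [measurable]: "ball y R \<in> sets borel" by simp
    show "(\<lambda>x. W x * (indicator (ball y R) x / norm (x - y))) \<in> borel_measurable lborel"
      by measurable
    show "AE x in lborel. 0 \<le> W x * (indicator (ball y R) x / norm (x - y))"
      by (simp add: W_nonneg)
    have "(\<integral>\<^sup>+x. ennreal (W x * (indicator (ball y R) x / norm (x - y))) \<partial>lborel)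
        = (\<integral>\<^sup>+x\<in>ball y R. ennreal (W x / norm (x - y)) \<partial>lborel)"
      by (rule nn_integral_cong) (simp split: split_indicator)
    with fin show "(\<integral>\<^sup>+x. ennreal (W x * (indicator (ball y R) x / norm (x - y))) \<partial>lborel) < \<infinity>"
      by simp
  qed
  \<comment> \<open>\<open>Q\<close> is the Kato integral of \<open>W\<close> at \<open>y\<close>,
    \<open>N\<close> bounds the mass of the negative part near \<open>y\<close>, and 1 bounds its
    contribution far from \<open>y\<close>. None of them, nor \<open>c\<close>, depends on
    \<epsilon>, although \<rho>, \<open>M\<close> and \<open>s\<close> below do.\<close>
  have main: "ln ((\<delta> + \<epsilon>) / \<epsilon>) * c \<le> Q + N + 1" if \<epsilon>: "\<epsilon> > 0" for \<epsilon>
  proof -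
    let ?l = "\<lambda>x. ln ((f x + \<epsilon>) / \<epsilon>)"
    have lc: "continuous_on UNIV ?l" by (rule continuous_ln_quotient[OF f_continuous f_nonneg \<epsilon>])
    have l0: "0 \<le> ?l x" for x using f_nonneg[of x] \<epsilon> by (simp add: ln_ge_zero_iff field_simps)
    \<comment> \<open>Here \<open>f y = 0\<close> enters: within \<rho> of \<open>y\<close> the
      logarithm is at most 1, so the concentrating part costs at most its mass. Farther out
      \<open>?l\<close> is bounded by \<open>M\<close>, and \<open>s\<close> is taken so small that
      the part of order \<open>s\<^sup>2\<close> contributes less than 1.\<close>
    have "?l y = 0" using \<epsilon> fy by simp
    then obtain \<rho> where \<rho>: "\<rho> > 0" "\<And>x. dist y x \<le> \<rho> \<Longrightarrow> ?l x \<le> 1"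
      using uniformly_continuous_cball[OF lc zero_less_one, of y 0]
      by (metis (no_types, lifting) abs_le_D2 add.commute centre_in_cball diff_0 minus_minus order_refl)
    obtain M where M: "M > 0" "\<And>x. x \<in> cball y R \<Longrightarrow> \<bar>?l x\<bar> \<le> M"
      using bounded_cball_continuous[OF lc] by metis
    define v where "v = measure lborel (cball y R)"
    have "((\<lambda>s. M * (3 * s\<^sup>2 / \<rho> ^ 5) * v) \<longlongrightarrow> M * (3 * 0\<^sup>2 / \<rho> ^ 5) * v) (at_right 0)"
      using \<rho>(1) by (intro tendsto_intros) auto
    then have "\<forall>\<^sub>F s in at_right 0. M * (3 * s\<^sup>2 / \<rho> ^ 5) * v < 1"
      by (rule order_tendstoD) simp
    moreover have "((\<lambda>s. R1\<^sup>2 + s\<^sup>2) \<longlongrightarrow> R1\<^sup>2 + 0\<^sup>2) (at_right 0)"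
      by (intro tendsto_intros)
    then have "\<forall>\<^sub>F s in at_right 0. R1\<^sup>2 + s\<^sup>2 < R2\<^sup>2"
      by (rule order_tendstoD) (use R12 in \<open>simp add: power_strict_mono\<close>)
    moreover have "\<forall>\<^sub>F s::real in at_right 0. s > 0"
      by (rule eventually_at_right_less)
    ultimately have "\<forall>\<^sub>F s in at_right 0. M * (3 * s\<^sup>2 / \<rho> ^ 5) * v < 1 \<and> R1\<^sup>2 + s\<^sup>2 < R2\<^sup>2 \<and> s > 0"
      by eventually_elim auto
    then obtain s where s: "M * (3 * s\<^sup>2 / \<rho> ^ 5) * v < 1" "R1\<^sup>2 + s\<^sup>2 < R2\<^sup>2" "s > 0"
      using eventually_happens'[OF trivial_limit_at_right_real] by blast
    note bi = integrable_barrier_parts[OF s(3) R lc]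
    note bi1 = integrable_barrier_parts[OF s(3) R continuous_on_const[of _ 1], simplified]
    have vi: "integrable lborel (\<lambda>x. M * (3 * s\<^sup>2 / \<rho> ^ 5) * indicator (cball y R) x :: real)"
      by (rule integrable_mult_right, rule integrable_real_indicator[OF _ emeasure_lborel_cball_finite]) simp
    have "ln ((\<delta> + \<epsilon>) / \<epsilon>) * c = (LINT x|lborel. ln ((\<delta> + \<epsilon>) / \<epsilon>) * a * indicator (ball x1 r) x)"
      by (simp add: c_def)
    also have "\<dots> \<le> (LINT x|lborel. ?l x * barrier_pos R s y x)"
    proof (rule integral_mono[OF _ bi(1)])
      show "integrable lborel (\<lambda>x. ln ((\<delta> + \<epsilon>) / \<epsilon>) * a * indicator (ball x1 r) x :: real)"
        by (rule integrable_mult_right, rule integrable_real_indicator[OF _ emeasure_lborel_ball_finite]) simp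
      show "ln ((\<delta> + \<epsilon>) / \<epsilon>) * a * indicator (ball x1 r) x \<le> ?l x * barrier_pos R s y x" for x
      proof (cases "x \<in> ball x1 r")
        case True
        have "(norm (x - y))\<^sup>2 \<le> R1\<^sup>2" using near(3)[OF True] by (intro power_mono) auto
        then have "(norm (x - y))\<^sup>2 + s\<^sup>2 \<le> R2\<^sup>2" using s(2) by linarith
        then have "a \<le> barrier_pos R s y x" unfolding a_def
          using near(2)[OF True] s(3) R12 D by (intro barrier_pos_ge) auto
        moreover have "ln ((\<delta> + \<epsilon>) / \<epsilon>) \<le> ?l x"
          using near(1)[OF True] \<delta> \<epsilon> by (intro ln_mono divide_right_mono) auto
        ultimately show ?thesis using True l0[of x] \<open>a > 0\<close> by (simp add: mult_mono)
      qed (simp add: l0 barrier_nonneg[OF s(3)])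
    qed
    also have "\<dots> = (LINT x|lborel. ?l x * laplacian (barrier R s y) x) + (LINT x|lborel. ?l x * barrier_neg R s y x)"
      by (simp add: barrier_C_2_laplacian(2)[OF s(3)] right_diff_distrib bi)
    also have "(LINT x|lborel. ?l x * laplacian (barrier R s y) x) \<le> (LINT x|lborel. W x * barrier R s y x)"
      by (rule integral_ln_laplacian_le[OF \<epsilon> barrier_C_2_laplacian(1)[OF s(3)], of y R])
        (auto simp: barrier_zero[OF s(3) R] barrier_nonneg[OF s(3)])
    also have "\<dots> \<le> Q" unfolding Q_def
    proof (rule integral_mono_AE[OF _ Qi])
      show "integrable lborel (\<lambda>x. W x * barrier R s y x)"
        by (rule integrable_W_mult[of _ y R]) (auto intro!: C_k_imp_continuous barrier_C_2_laplacian(1)[OF s(3)]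
            simp: barrier_zero[OF s(3) R])
      show "AE x in lborel. W x * barrier R s y x \<le> W x * (indicator (ball y R) x / norm (x - y))"
        by (rule eventually_mono[OF AE_lborel_singleton[of y]])
          (intro mult_left_mono W_nonneg barrier_le s(3) R)
    qed
    also have "(LINT x|lborel. ?l x * barrier_neg R s y x)
        \<le> (LINT x|lborel. barrier_neg R s y x + M * (3 * s\<^sup>2 / \<rho> ^ 5) * indicator (cball y R) x)"
    proof (rule integral_mono[OF bi(2) Bochner_Integration.integrable_add[OF bi1(2) vi]])
      fix x
      let ?e = "M * (3 * s\<^sup>2 / \<rho> ^ 5) * indicator (cball y R) x"
      consider "x \<notin> cball y R" | "dist y x \<le> \<rho>" | "x \<in> cball y R" "\<rho> \<le> norm (x - y)"
        by (fastforce simp: dist_norm norm_minus_commute)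
      then show "?l x * barrier_neg R s y x \<le> barrier_neg R s y x + ?e"
      proof cases
        case 1
        then show ?thesis by (simp add: barrier_zero[OF s(3) R])
      next
        case 2
        have "?l x * barrier_neg R s y x \<le> 1 * barrier_neg R s y x"
          by (intro mult_right_mono \<rho>(2)[OF 2] barrier_nonneg[OF s(3)])
        moreover have "0 \<le> ?e" using M(1) \<rho>(1) by simp
        ultimately show ?thesis by linarith
      next
        case 3
        have "?l x * barrier_neg R s y x \<le> M * (3 * s\<^sup>2 / \<rho> ^ 5)"
          using M(2)[OF 3(1)] M(1) l0[of x]
          by (intro mult_mono barrier_neg_le[OF s(3) \<rho>(1) 3(2)] barrier_nonneg[OF s(3)]) auto
        with 3(1) show ?thesis using barrier_nonneg(3)[OF s(3), of R y x] by simp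
      qed
    qed
    also have "\<dots> = (LINT x|lborel. barrier_neg R s y x) + M * (3 * s\<^sup>2 / \<rho> ^ 5) * v"
      by (subst Bochner_Integration.integral_add[OF bi1(2) vi]) (simp add: v_def)
    also have "(LINT x|lborel. barrier_neg R s y x) \<le> N"
      unfolding N_def by (rule integral_barrier_neg_le[OF s(3) R])
    finally show ?thesis using s(1) by linarith
  qed
  \<comment> \<open>\<open>T\<close> exceeds the admissible value \<open>(Q + N + 1) / c\<close> by
    1, and \<epsilon> is solved from \<open>ln (\<delta> / \<epsilon>) = T\<close>.\<close>
  define T where "T = (Q + N + 1) / c + 1"
  define \<epsilon> where "\<epsilon> = \<delta> / exp T"
  have \<epsilon>: "\<epsilon> > 0" using \<delta> by (simp add: \<epsilon>_def)
  have "T = ln (\<delta> / \<epsilon>)" using \<delta> by (simp add: \<epsilon>_def)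
  also have "\<dots> \<le> ln ((\<delta> + \<epsilon>) / \<epsilon>)" using \<delta> \<epsilon> by (intro ln_mono divide_right_mono) auto
  finally have "T * c \<le> Q + N + 1" using main[OF \<epsilon>] c by (meson mult_right_mono less_imp_le order_trans)
  moreover have "T * c = Q + N + 1 + c" using c by (simp add: T_def field_simps)
  ultimately show False using c by simp
qed

end

section \<open>Continuity of Newtonian potentials\<close>

lemma inv_laplacian_integral:
  assumes "h \<in> borel_measurable borel"
  shows "inv_laplacian h x = (LINT y|lborel. - 1 / (4 * pi * norm (x - y)) * h y)"
  unfolding inv_laplacian_def
proof (rule integral_completion)
  note [measurable] = assms
  show "(\<lambda>y. - 1 / (4 * pi * norm (x - y)) * h y) \<in> borel_measurable lborel" by measurable
qed

lemma Cc_infinityD: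
  assumes "\<phi> \<in> Cc_infinity"
  shows "C_k k \<phi>" "continuous_on UNIV \<phi>" "\<exists>B. \<forall>x. x \<notin> cball 0 B \<longrightarrow> \<phi> x = 0"
proof -
  show C: "C_k k \<phi>" for k using assms by (simp add: Cc_infinity_def)
  from C[of 0] show "continuous_on UNIV \<phi>" by simp
  have "bounded {x. \<phi> x \<noteq> 0}"
    using assms bounded_subset[OF compact_imp_bounded closure_subset] by (auto simp: Cc_infinity_def)
  then show "\<exists>B. \<forall>x. x \<notin> cball 0 B \<longrightarrow> \<phi> x = 0"
    by (fastforce simp: bounded_iff)
qed

text \<open>Compact support permits truncating the Newtonian kernel, which is then integrable; after
  a translation the dependence on \<open>x\<close> sits in the continuous factor \<phi>.\<close>

lemma inv_laplacian_Cc: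
  assumes "\<phi> \<in> Cc_infinity"
  shows "continuous_on UNIV (inv_laplacian \<phi>)"
    and "integrable lebesgue (\<lambda>y. - 1 / (4 * pi * norm (x - y)) * \<phi> y)"
proof -
  note c = Cc_infinityD(2)[OF assms]
  obtain B where B: "\<And>x. x \<notin> cball 0 B \<Longrightarrow> \<phi> x = 0" using Cc_infinityD(3)[OF assms] by auto
  note [measurable] = borel_continuous[OF c]
  define k where "k = (\<lambda>r (y :: real^3) z. - 1 / (4 * pi) * (indicator (cball y r) z / norm (z - y)))"
  have ki: "integrable lborel (k r y)" for r y
    unfolding k_def by (rule integrable_mult_right) (rule integrable_inverse_norm)
  have "integrable lborel (\<lambda>y. k (norm x + B) x y * \<phi> y)"
    by (rule integrable_mult_continuous[OF ki, of x "norm x + B"]) (simp_all add: k_def c)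
  also have "(\<lambda>y. k (norm x + B) x y * \<phi> y) = (\<lambda>y. - 1 / (4 * pi * norm (x - y)) * \<phi> y)"
  proof
    fix y
    show "k (norm x + B) x y * \<phi> y = - 1 / (4 * pi * norm (x - y)) * \<phi> y"
    proof (cases "y \<in> cball 0 B")
      case True
      then have "y \<in> cball x (norm x + B)"
        using norm_triangle_ineq4[of x y] by (simp add: dist_norm)
      then show ?thesis by (simp add: k_def norm_minus_commute)
    qed (simp add: B)
  qed
  finally show "integrable lebesgue (\<lambda>y. - 1 / (4 * pi * norm (x - y)) * \<phi> y)"
    by (rule integrable_completion[THEN iffD2, rotated]) measurable
  have "isCont (inv_laplacian \<phi>) x0" for x0
  proof -
    \<comment> \<open>One radius for all \<open>x\<close> in the unit ball around \<open>x0\<close>: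
      if \<open>\<phi> (x + z)\<close> is nonzero, then
      \<open>norm z \<le> norm x + B\<close>.\<close>
    let ?k = "k (norm x0 + 1 + B) 0"
    have eq: "inv_laplacian \<phi> x = (LINT z|lborel. ?k z * \<phi> (x + z))" if "x \<in> ball x0 1" for x
    proof -
      have "inv_laplacian \<phi> x = (LINT y|lborel. - 1 / (4 * pi * norm (x - y)) * \<phi> y)"
        by (rule inv_laplacian_integral) measurable
      also have "\<dots> = (LINT z|lborel. - 1 / (4 * pi * norm (x - (x + z))) * \<phi> (x + z))"
        by (rule integral_lborel_translate[symmetric]) measurable
      also have "\<dots> = (LINT z|lborel. ?k z * \<phi> (x + z))"
      proof (rule Bochner_Integration.integral_cong[OF refl])
        fix z
        show "- 1 / (4 * pi * norm (x - (x + z))) * \<phi> (x + z) = ?k z * \<phi> (x + z)"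
        proof (cases "x + z \<in> cball 0 B")
          case True
          have "norm z \<le> norm (x + z) + norm x"
            using norm_triangle_ineq4[of "x + z" x] by simp
          moreover have "norm x < norm x0 + 1"
            using that norm_triangle_ineq2[of x x0] by (simp add: dist_norm norm_minus_commute)
          ultimately have "z \<in> cball 0 (norm x0 + 1 + B)" using True by simp
          then show ?thesis by (simp add: k_def)
        qed (simp add: B)
      qed
      finally show ?thesis .
    qed
    have "continuous_on UNIV (\<lambda>x. LINT z|lborel. ?k z * \<phi> (x + z))"
      by (rule integral_kernel_continuous[OF c ki, of "norm x0 + 1 + B"]) (simp add: k_def)
    then have "continuous_on (ball x0 1) (\<lambda>x. LINT z|lborel. ?k z * \<phi> (x + z))"
      by (rule continuous_on_subset) simp
    then have "continuous_on (ball x0 1) (inv_laplacian \<phi>)"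
      by (rule continuous_on_eq) (simp add: eq)
    then show ?thesis by (simp add: continuous_on_eq_continuous_at)
  qed
  then show "continuous_on UNIV (inv_laplacian \<phi>)"
    by (simp add: continuous_on_eq_continuous_at)
qed

text \<open>Since \<open>1 / (4 pi) \<le> 1\<close>, the Kato norm dominates the supremum of the
  Newtonian potential, so approximation in the Kato norm becomes uniform approximation of
  potentials.\<close>

lemma inv_laplacian_diff_le:
  assumes h: "h \<in> borel_measurable lebesgue" and \<phi>: "\<phi> \<in> Cc_infinity"
    and e: "e > 0" "kato_norm (\<lambda>x. h x - \<phi> x) < ennreal e"
  shows "\<bar>inv_laplacian h x - inv_laplacian \<phi> x\<bar> \<le> e"
proof -
  let ?K = "\<lambda>y. - 1 / (4 * pi * norm (x - y))"
  let ?d = "\<lambda>y. ?K y * (h y - \<phi> y)"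
  have [measurable]: "\<phi> \<in> borel_measurable lebesgue"
    by (rule measurable_completion) (simp add: borel_continuous Cc_infinityD(2)[OF \<phi>])
  note [measurable] = h
  have K: "?K \<in> borel_measurable lebesgue"
    by (rule measurable_completion) measurable
  have dm: "?d \<in> borel_measurable lebesgue"
    by (intro borel_measurable_times K) measurable
  have "ennreal (norm (?d y)) \<le> ennreal (\<bar>h y - \<phi> y\<bar> / norm (y - x))" for y
  proof (rule ennreal_leI)
    have "1 \<le> 4 * pi" using pi_gt3 by simp
    then have "\<bar>h y - \<phi> y\<bar> / norm (y - x) / (4 * pi) \<le> \<bar>h y - \<phi> y\<bar> / norm (y - x) / 1"
      by (intro divide_left_mono) auto
    then show "norm (?d y) \<le> \<bar>h y - \<phi> y\<bar> / norm (y - x)"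
      by (simp add: abs_mult norm_minus_commute mult_ac)
  qed
  then have "(\<integral>\<^sup>+y. ennreal (norm (?d y)) \<partial>lebesgue) \<le> (\<integral>\<^sup>+y. ennreal (\<bar>h y - \<phi> y\<bar> / norm (y - x)) \<partial>lebesgue)"
    by (intro nn_integral_mono)
  also have "\<dots> \<le> kato_norm (\<lambda>x. h x - \<phi> x)"
    unfolding kato_norm_def by (rule SUP_upper) simp
  finally have le: "(\<integral>\<^sup>+y. ennreal (norm (?d y)) \<partial>lebesgue) \<le> ennreal e" using e(2) by simp
  also have "\<dots> < \<infinity>" by simp
  finally have di: "integrable lebesgue ?d" by (intro integrableI_bounded dm)
  have eq: "?K y * h y = ?d y + ?K y * \<phi> y" for y by (simp add: right_diff_distrib)
  have "inv_laplacian h x = (LINT y|lebesgue. ?d y) + inv_laplacian \<phi> x"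
    unfolding inv_laplacian_def eq
    by (rule Bochner_Integration.integral_add[OF di inv_laplacian_Cc(2)[OF \<phi>]])
  moreover have "ennreal (norm (LINT y|lebesgue. ?d y)) \<le> ennreal e"
    using integral_norm_bound_ennreal[OF di] le by (rule order_trans)
  ultimately show ?thesis using e(1) by simp
qed

lemma inv_laplacian_continuous:
  assumes "h \<in> K_0"
  shows "continuous_on UNIV (inv_laplacian h)"
  unfolding continuous_on_iff
proof (intro ballI allI impI)
  fix x and e :: real assume "e > 0"
  \<comment> \<open>Three errors occur: the approximation at both points and the variation of the
    approximant. Quarters keep their sum below \<open>e\<close>.\<close>
  then have e: "e / 4 > 0" by simp
  obtain \<phi> where \<phi>: "\<phi> \<in> Cc_infinity" "kato_norm (\<lambda>x. h x - \<phi> x) < ennreal (e / 4)"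
    using assms e unfolding K_0_def by blast
  have m: "h \<in> borel_measurable lebesgue" using assms by (simp add: K_0_def)
  note b = inv_laplacian_diff_le[OF m \<phi>(1) e \<phi>(2)]
  obtain d where d: "d > 0" "\<And>x'. dist x' x < d \<Longrightarrow> dist (inv_laplacian \<phi> x') (inv_laplacian \<phi> x) < e / 4"
    using inv_laplacian_Cc(1)[OF \<phi>(1)] e unfolding continuous_on_iff by (metis UNIV_I)
  show "\<exists>d>0. \<forall>x'\<in>UNIV. dist x' x < d \<longrightarrow> dist (inv_laplacian h x') (inv_laplacian h x) < e"
  proof (intro exI[of _ d] conjI ballI impI d(1))
    fix x' assume "dist x' x < d"
    from d(2)[OF this] b[of x] b[of x'] \<open>e > 0\<close>
    show "dist (inv_laplacian h x') (inv_laplacian h x) < e"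
      unfolding dist_real_def by linarith
  qed
qed

lemma locally_in_continuous:
  assumes "f \<in> locally_in X" and "\<And>u. u \<in> X \<Longrightarrow> continuous_on UNIV u"
  shows "continuous_on UNIV f"
proof -
  have "isCont f y" for y
  proof -
    obtain r u where r: "r > 0" "u \<in> X" "\<And>x. x \<in> ball y r \<Longrightarrow> f x = u x"
      using assms(1) unfolding locally_in_def by blast
    have "continuous_on (ball y r) u" using assms(2)[OF r(2)] by (rule continuous_on_subset) simp
    then have "continuous_on (ball y r) f" by (rule continuous_on_eq) (simp add: r(3))
    with r(1) show ?thesis by (simp add: continuous_on_eq_continuous_at)
  qed
  then show ?thesis by (simp add: continuous_on_eq_continuous_at)
qed

section \<open>The strong maximum principle\<close>

text \<open>A finite subcover of the ball, with \<open>g\<close> read as the density of a measure so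
  that finite subadditivity applies.\<close>

lemma finite_nn_integral_cball:
  fixes g :: "'a::euclidean_space \<Rightarrow> ennreal"
  assumes g: "g \<in> borel_measurable borel" and loc: "\<And>y. \<exists>R>0. (\<integral>\<^sup>+x\<in>ball y R. g x \<partial>lborel) < \<infinity>"
  shows "(\<integral>\<^sup>+x\<in>cball y r. g x \<partial>lborel) < \<infinity>"
proof -
  obtain R where R: "\<And>y. R y > 0" "\<And>y. (\<integral>\<^sup>+x\<in>ball y (R y). g x \<partial>lborel) < \<infinity>"
    using loc by metis
  obtain C where C: "finite C" "cball y r \<subseteq> (\<Union>z\<in>C. ball z (R z))"
  proof (rule compactE_image[of "cball y r" UNIV "\<lambda>z. ball z (R z)"])
    show "cball y r \<subseteq> (\<Union>z\<in>UNIV. ball z (R z))"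
    proof
      fix x
      have "x \<in> ball x (R x)" by (simp add: R(1))
      then show "x \<in> (\<Union>z\<in>UNIV. ball z (R z))" by blast
    qed
  qed auto
  let ?M = "density lborel g"
  have em: "emeasure ?M A = (\<integral>\<^sup>+x\<in>A. g x \<partial>lborel)" if "A \<in> sets borel" for A
    using that g by (simp add: emeasure_density)
  have "emeasure ?M (cball y r) \<le> emeasure ?M (\<Union>z\<in>C. ball z (R z))"
    by (rule emeasure_mono[OF C(2)]) (auto intro!: sets.finite_UN C(1))
  also have "\<dots> \<le> (\<Sum>z\<in>C. emeasure ?M (ball z (R z)))"
    by (rule emeasure_subadditive_finite[OF C(1)]) auto
  also have "\<dots> < \<infinity>"
    using R(2) by (auto simp: em less_top[symmetric] C(1))
  finally show ?thesis by (simp add: em)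
qed

text \<open>The Kato condition passes to a Borel representative, which the product-measure argument
  in \<open>integral_conv_W\<close> requires.\<close>

lemma K_loc_lborel:
  assumes V: "V \<in> K_loc" and U: "U \<in> borel_measurable borel" "AE x in lborel. V x = U x"
  obtains R where "R > 0" "(\<integral>\<^sup>+x\<in>ball y R. ennreal (\<bar>U x\<bar> / norm (x - y)) \<partial>lborel) < \<infinity>"
proof -
  obtain R where R: "R > 0" "(\<integral>\<^sup>+x\<in>ball y R. ennreal (\<bar>V x\<bar> / norm (x - y)) \<partial>lebesgue) < \<infinity>"
    using V unfolding K_loc_def by blast
  have "(\<integral>\<^sup>+x\<in>ball y R. ennreal (\<bar>U x\<bar> / norm (x - y)) \<partial>lborel)
      = (\<integral>\<^sup>+x\<in>ball y R. ennreal (\<bar>V x\<bar> / norm (x - y)) \<partial>lborel)"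
    by (rule nn_integral_cong_AE) (use U(2) in \<open>auto elim!: eventually_mono\<close>)
  with R show ?thesis by (intro that[of R]) (simp_all add: nn_integral_completion)
qed

text \<open>On \<open>ball y R\<close> one has \<open>|U| \<le> R * (|U| / |x - y|)\<close> off the
  null set \<open>{y}\<close>, so the Kato condition implies local integrability.\<close>

lemma K_loc_set_integrable:
  assumes V: "V \<in> K_loc" and U: "U \<in> borel_measurable borel" "AE x in lborel. V x = U x"
  shows "set_integrable lborel (cball y r) U"
proof -
  note [measurable] = U(1)
  have "\<exists>R>0. (\<integral>\<^sup>+x\<in>ball y R. ennreal \<bar>U x\<bar> \<partial>lborel) < \<infinity>" for y
  proof -
    obtain R where R: "R > 0" "(\<integral>\<^sup>+x\<in>ball y R. ennreal (\<bar>U x\<bar> / norm (x - y)) \<partial>lborel) < \<infinity>"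
      using K_loc_lborel[OF assms] .
    have [measurable]: "ball y R \<in> sets borel" by simp
    have "ennreal \<bar>U x\<bar> * indicator (ball y R) x
        \<le> ennreal R * (ennreal (\<bar>U x\<bar> / norm (x - y)) * indicator (ball y R) x)" if "x \<noteq> y" for x
    proof (cases "x \<in> ball y R")
      case True
      then have n: "0 < norm (x - y)" "norm (x - y) \<le> R" using that by (auto simp: dist_norm norm_minus_commute)
      have "\<bar>U x\<bar> = norm (x - y) * (\<bar>U x\<bar> / norm (x - y))" using n by simp
      also have "\<dots> \<le> R * (\<bar>U x\<bar> / norm (x - y))" using n by (intro mult_right_mono) auto
      finally have "ennreal \<bar>U x\<bar> \<le> ennreal (R * (\<bar>U x\<bar> / norm (x - y)))" by (rule ennreal_leI)
      also have "\<dots> = ennreal R * ennreal (\<bar>U x\<bar> / norm (x - y))"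
        using R(1) by (intro ennreal_mult) auto
      finally show ?thesis using True by simp
    qed simp
    then have "(\<integral>\<^sup>+x\<in>ball y R. ennreal \<bar>U x\<bar> \<partial>lborel)
        \<le> (\<integral>\<^sup>+x. ennreal R * (ennreal (\<bar>U x\<bar> / norm (x - y)) * indicator (ball y R) x) \<partial>lborel)"
      by (intro nn_integral_mono_AE eventually_mono[OF AE_lborel_singleton[of y]])
    also have "\<dots> = ennreal R * (\<integral>\<^sup>+x\<in>ball y R. ennreal (\<bar>U x\<bar> / norm (x - y)) \<partial>lborel)"
      by (rule nn_integral_cmult) measurable
    also have "\<dots> < \<infinity>" using R(2) by (simp add: ennreal_mult_less_top)
    finally show ?thesis using R(1) by blast
  qed
  then have "(\<integral>\<^sup>+x\<in>cball y r. ennreal \<bar>U x\<bar> \<partial>lborel) < \<infinity>"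
    by (intro finite_nn_integral_cball) measurable
  also have "(\<integral>\<^sup>+x\<in>cball y r. ennreal \<bar>U x\<bar> \<partial>lborel)
      = (\<integral>\<^sup>+x. ennreal (norm (indicator (cball y r) x *\<^sub>R U x)) \<partial>lborel)"
    by (rule nn_integral_cong) (simp split: split_indicator)
  finally have fin: "(\<integral>\<^sup>+x. ennreal (norm (indicator (cball y r) x *\<^sub>R U x)) \<partial>lborel) < \<infinity>" .
  have [measurable]: "cball y r \<in> sets borel" by simp
  show ?thesis unfolding set_integrable_def
    by (rule integrableI_bounded[OF _ fin]) measurable
qed

lemma supersolution_of_schroedinger:
  assumes V: "V \<in> K_loc" and U: "U \<in> borel_measurable borel" "AE x in lborel. V x = U x"
    and f: "continuous_on UNIV f" "\<And>x. 0 \<le> f x"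
    and g: "AE x in lebesgue. 0 \<le> g x" and sol: "schroedinger_solution V f g"
  shows "supersolution f (\<lambda>x. max 0 (U x))"
proof
  note [measurable] = U(1) borel_continuous[OF f(1)]
  note Ui = K_loc_set_integrable[OF V U]
  show Wi: "set_integrable lborel (cball y R) (\<lambda>x. max 0 (U x))" for y R
  proof -
    have [measurable]: "cball y R \<in> sets borel" by simp
    show ?thesis
      using Ui[of y R] unfolding set_integrable_def
      by (rule Bochner_Integration.integrable_bound) (auto split: split_indicator)
  qed
  fix \<phi> assume \<phi>: "\<phi> \<in> Cc_infinity" and \<phi>0: "\<And>x. 0 \<le> \<phi> x"
  have \<phi>c: "continuous_on UNIV \<phi>" by (rule Cc_infinityD(2)[OF \<phi>])
  have lc: "continuous_on UNIV (laplacian \<phi>)"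
    by (rule laplacian_continuous[OF Cc_infinityD(1)[OF \<phi>]])
  note [measurable] = borel_continuous[OF \<phi>c] borel_continuous[OF lc]
  obtain B where B: "\<And>x. x \<notin> cball 0 B \<Longrightarrow> \<phi> x = 0" using Cc_infinityD(3)[OF \<phi>] by auto
  have l0: "x \<notin> cball 0 B \<Longrightarrow> laplacian \<phi> x = 0" for x
    by (rule laplacian_zero[OF closed_cball B])
  have i1: "integrable lborel (\<lambda>x. f x * laplacian \<phi> x)"
    by (rule integrable_mult_cpt_support[OF set_integrable_cball_continuous[OF f(1)] lc l0])
  have f\<phi>: "continuous_on UNIV (\<lambda>x. f x * \<phi> x)" "x \<notin> cball 0 B \<Longrightarrow> f x * \<phi> x = 0" for x
    using B by (auto intro!: continuous_intros f(1) \<phi>c)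
  have i2: "integrable lborel (\<lambda>x. U x * (f x * \<phi> x))"
    by (rule integrable_mult_cpt_support[OF Ui f\<phi>])
  have i3: "integrable lborel (\<lambda>x. max 0 (U x) * (f x * \<phi> x))"
    by (rule integrable_mult_cpt_support[OF Wi f\<phi>])
  have Vm: "V \<in> borel_measurable lebesgue" using V by (simp add: K_loc_def)
  have m: "w \<in> borel_measurable lebesgue" if "w \<in> borel_measurable borel" for w :: "real^3 \<Rightarrow> real"
    using that by (intro measurable_completion) simp
  have "0 \<le> (LINT x|lebesgue. g x * \<phi> x)"
    by (rule integral_nonneg_AE) (use g in \<open>auto elim!: eventually_mono simp: \<phi>0\<close>)
  also have "\<dots> = (LINT x|lebesgue. - f x * laplacian \<phi> x + V x * f x * \<phi> x)"
    using sol \<phi> unfolding schroedinger_solution_def by simp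
  also have "\<dots> = (LINT x|lebesgue. - f x * laplacian \<phi> x + U x * f x * \<phi> x)"
  proof (rule integral_cong_AE)
    note [measurable] = Vm m[OF U(1)] m[OF borel_continuous[OF f(1)]] m[OF borel_continuous[OF \<phi>c]]
      m[OF borel_continuous[OF lc]]
    show "(\<lambda>x. - f x * laplacian \<phi> x + V x * f x * \<phi> x) \<in> borel_measurable lebesgue"
      "(\<lambda>x. - f x * laplacian \<phi> x + U x * f x * \<phi> x) \<in> borel_measurable lebesgue"
      by measurable
    show "AE x in lebesgue. - f x * laplacian \<phi> x + V x * f x * \<phi> x = - f x * laplacian \<phi> x + U x * f x * \<phi> x"
      using AE_completion[OF U(2)] by (auto elim!: eventually_mono)
  qed
  also have "\<dots> = (LINT x|lborel. - f x * laplacian \<phi> x + U x * f x * \<phi> x)"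
    by (rule integral_completion) measurable
  also have "\<dots> = (LINT x|lborel. U x * (f x * \<phi> x)) - (LINT x|lborel. f x * laplacian \<phi> x)"
    by (simp add: Bochner_Integration.integral_diff[OF i2 i1, symmetric] mult.assoc)
  finally have "(LINT x|lborel. f x * laplacian \<phi> x) \<le> (LINT x|lborel. U x * (f x * \<phi> x))" by simp
  also have "\<dots> \<le> (LINT x|lborel. max 0 (U x) * (f x * \<phi> x))"
    by (rule integral_mono[OF i2 i3]) (intro mult_right_mono, auto simp: f(2) \<phi>0)
  finally show "(LINT x|lborel. f x * laplacian \<phi> x) \<le> (LINT x|lborel. max 0 (U x) * (f x * \<phi> x))" .
qed (use f U(1) in auto)

theorem proposition3p1:
  fixes V f g :: "real^3 \<Rightarrow> real"
  assumes "V \<in> K_loc"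
    and "\<forall>x. f x \<ge> 0"
    and "f \<in> locally_in (inv_laplacian ` K_0)"
    and "g \<in> L1_loc"
    and "AE x in lebesgue. g x \<ge> 0"
    and "schroedinger_solution V f g"
    and "Liminf at_infinity (\<lambda>x. ereal (f x)) \<ge> 0"
    and "\<exists>x. f x \<noteq> 0"
  shows "\<forall>x. f x > 0"
proof -
  have fc: "continuous_on UNIV f"
    by (rule locally_in_continuous[OF assms(3)]) (auto intro: inv_laplacian_continuous)
  have "V \<in> borel_measurable lebesgue" using assms(1) by (simp add: K_loc_def)
  \<comment> \<open>\<open>V\<close> is only Lebesgue measurable; modifying it on a null set leaves
    the Kato integrals and the tested equation unchanged.\<close>
  then obtain U where U: "U \<in> borel_measurable borel" "AE x in lborel. V x = U x"
    using completion_ex_borel_measurable_real[of V lborel] by auto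
  interpret supersolution f "\<lambda>x. max 0 (U x)"
    by (rule supersolution_of_schroedinger[OF assms(1) U fc _ assms(5,6)]) (use assms(2) in simp)
  let ?Z = "{x. f x = 0}"
  have "open ?Z"
    unfolding open_contains_ball
  proof
    fix y assume "y \<in> ?Z"
    obtain R where R: "R > 0" "(\<integral>\<^sup>+x\<in>ball y R. ennreal (\<bar>U x\<bar> / norm (x - y)) \<partial>lborel) < \<infinity>"
      using K_loc_lborel[OF assms(1) U] .
    have "(\<integral>\<^sup>+x\<in>ball y R. ennreal (max 0 (U x) / norm (x - y)) \<partial>lborel)
        \<le> (\<integral>\<^sup>+x\<in>ball y R. ennreal (\<bar>U x\<bar> / norm (x - y)) \<partial>lborel)"
      by (intro nn_integral_mono mult_right_mono ennreal_leI divide_right_mono) auto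
    also note R(2)
    finally have "ball y R \<subseteq> ?Z"
      using zero_propagates[OF R(1)] \<open>y \<in> ?Z\<close> by blast
    with R(1) show "\<exists>R>0. ball y R \<subseteq> ?Z" by blast
  qed
  moreover have "closed ?Z"
    using fc by (intro closed_Collect_eq) auto
  ultimately have "?Z = {} \<or> ?Z = UNIV"
    by (intro clopen[THEN iffD1] conjI)
  with assms(8) have "f x \<noteq> 0" for x by auto
  with assms(2) show ?thesis by (metis less_eq_real_def)
qed

end
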